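(* Let $G$ be a finite group. Let $S$ be a nonabelian finite simple group which is not isomorphic to any of the following groups: (1) $A_{n}(q)=\mathrm{PSL}_{n+1}(q)$ with $q=p^{f}$ and $n+1>2$; (2) $D_{n}(q)$ with $q=p^{f}$ when $n=4$ or $p=2$; (3) $E_{6}(q)$ with $q=p^f$; (4) ${}^2A_{n}(q)$ with $n>1$. If exactly one composition factor of $G$ (counted with multiplicity) is isomorphic to $S$, then $\beta(G)$ is not solvable.
   Context: For a finite group $G$ and $N\trianglelefteq G$, define the rational number $m_{G,N}=\frac{1}{|G|}\sum_{X\le G,\ XN=G}|X|\,\mu(X,G)$, where $\mu$ is the Möbius function of the poset of subgroups of $G$. If $N\trianglelefteq G$ is maximal (with respect to inclusion) among normal subgroups with $m_{G,N}\neq 0$, set $\beta(G)=G/N$; this is well defined up to isomorphism (any two such maximal $N$ give isomorphic quotients). Here $q$ is a power of a prime $p$, and $A_n(q)$, $D_n(q)$, $E_6(q)$, ${}^2A_n(q)$ denote the usual (Chevalley / twisted Chevalley) finite simple groups of Lie type. Other nonabelian simple groups may occur as composition factors of $G$. *)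

theory Defs
  imports "HOL-Algebra.Algebra" "HOL-Combinatorics.Permutations"
begin

definition center :: "('a, 'b) monoid_scheme \<Rightarrow> 'a set" where
  "center G = {x \<in> carrier G. \<forall>y \<in> carrier G. x \<otimes>\<^bsub>G\<^esub> y = y \<otimes>\<^bsub>G\<^esub> x}"

definition comp_series :: "('a, 'b) monoid_scheme \<Rightarrow> 'a set list \<Rightarrow> bool" where
  "comp_series G Hs \<longleftrightarrow> Hs \<noteq> [] \<and> hd Hs = carrier G \<and> last Hs = {\<one>\<^bsub>G\<^esub>}
     \<and> (\<forall>i < length Hs. subgroup (Hs ! i) G)
     \<and> (\<forall>i. Suc i < length Hs \<longrightarrow>
           Hs ! Suc i \<lhd> G\<lparr>carrier := Hs ! i\<rparr> \<and>
           simple_group (G\<lparr>carrier := Hs ! i\<rparr> Mod (Hs ! Suc i)))"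

definition comp_mult :: "('a, 'b) monoid_scheme \<Rightarrow> 'a set list \<Rightarrow> ('c, 'd) monoid_scheme \<Rightarrow> nat" where
  "comp_mult G Hs S = card {i. Suc i < length Hs \<and> (G\<lparr>carrier := Hs ! i\<rparr> Mod (Hs ! Suc i)) \<cong> S}"

text \<open>Moebius function mu(Z, T) of a finite poset P of sets (ordered by inclusion) with top T,
  computed by the recursion mu(T,T) = 1, mu(Z,T) = - sum_{Z < Y <= T, Y in P} mu(Y,T);
  k bounds the recursion depth (any k at least the length of the longest chain suffices).\<close>
primrec mob_aux :: "nat \<Rightarrow> 'a set set \<Rightarrow> 'a set \<Rightarrow> 'a set \<Rightarrow> int" where
  "mob_aux 0 P T Z = (if Z = T then 1 else 0)"
| "mob_aux (Suc k) P T Z = (if Z = T then 1 else if Z \<in> P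
      then - (\<Sum>Y \<in> {Y \<in> P. Z \<subset> Y}. mob_aux k P T Y) else 0)"

text \<open>Moebius function mu(Z, G) of the subgroup lattice of the finite group G. Since every
  strictly increasing chain of subgroups has length at most |G|, depth |G| suffices.\<close>
definition sub_mobius :: "('a, 'b) monoid_scheme \<Rightarrow> 'a set \<Rightarrow> int" where
  "sub_mobius G Z = mob_aux (card (carrier G)) {Y. subgroup Y G} (carrier G) Z"

definition m_GN :: "('a, 'b) monoid_scheme \<Rightarrow> 'a set \<Rightarrow> rat" where
  "m_GN G N = (1 / of_nat (card (carrier G))) *
     (\<Sum>Z \<in> {Z. subgroup Z G \<and> Z <#>\<^bsub>G\<^esub> N = carrier G}.
        of_nat (card Z) * of_int (sub_mobius G Z))"

text \<open>N is a normal subgroup maximal (w.r.t. inclusion) among normal subgroups with m_{G,N} \<noteq> 0;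
  beta(G) is then G/N.\<close>
definition beta_kernel :: "('a, 'b) monoid_scheme \<Rightarrow> 'a set \<Rightarrow> bool" where
  "beta_kernel G N \<longleftrightarrow> N \<lhd> G \<and> m_GN G N \<noteq> 0 \<and>
     (\<forall>M. M \<lhd> G \<and> m_GN G M \<noteq> 0 \<and> N \<subseteq> M \<longrightarrow> M = N)"

definition mats :: "nat ring \<Rightarrow> nat \<Rightarrow> (nat \<Rightarrow> nat \<Rightarrow> nat) set" where
  "mats F n = {A. (\<forall>i j. i < n \<and> j < n \<longrightarrow> A i j \<in> carrier F) \<and>
                  (\<forall>i j. \<not> (i < n \<and> j < n) \<longrightarrow> A i j = 0)}"

definition mmult :: "nat ring \<Rightarrow> nat \<Rightarrow> (nat \<Rightarrow> nat \<Rightarrow> nat) \<Rightarrow> (nat \<Rightarrow> nat \<Rightarrow> nat) \<Rightarrow> (nat \<Rightarrow> nat \<Rightarrow> nat)" where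
  "mmult F n A B = (\<lambda>i j. if i < n \<and> j < n then (\<Oplus>\<^bsub>F\<^esub> k \<in> {..<n}. A i k \<otimes>\<^bsub>F\<^esub> B k j) else 0)"

definition mone :: "nat ring \<Rightarrow> nat \<Rightarrow> (nat \<Rightarrow> nat \<Rightarrow> nat)" where
  "mone F n = (\<lambda>i j. if i < n \<and> j < n then (if i = j then \<one>\<^bsub>F\<^esub> else \<zero>\<^bsub>F\<^esub>) else 0)"

definition mdet :: "nat ring \<Rightarrow> nat \<Rightarrow> (nat \<Rightarrow> nat \<Rightarrow> nat) \<Rightarrow> nat" where
  "mdet F n A = (\<Oplus>\<^bsub>F\<^esub> p \<in> {p. p permutes {..<n}}.
      (if sign p = 1 then \<one>\<^bsub>F\<^esub> else \<ominus>\<^bsub>F\<^esub> \<one>\<^bsub>F\<^esub>) \<otimes>\<^bsub>F\<^esub> (\<Otimes>\<^bsub>F\<^esub> i \<in> {..<n}. A i (p i)))"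

definition vecs :: "nat ring \<Rightarrow> nat \<Rightarrow> (nat \<Rightarrow> nat) set" where
  "vecs F n = {x. (\<forall>i < n. x i \<in> carrier F) \<and> (\<forall>i \<ge> n. x i = 0)}"

definition mvec :: "nat ring \<Rightarrow> nat \<Rightarrow> (nat \<Rightarrow> nat \<Rightarrow> nat) \<Rightarrow> (nat \<Rightarrow> nat) \<Rightarrow> (nat \<Rightarrow> nat)" where
  "mvec F n A x = (\<lambda>i. if i < n then (\<Oplus>\<^bsub>F\<^esub> k \<in> {..<n}. A i k \<otimes>\<^bsub>F\<^esub> x k) else 0)"

definition GL :: "nat ring \<Rightarrow> nat \<Rightarrow> (nat \<Rightarrow> nat \<Rightarrow> nat) monoid" where
  "GL F n = \<lparr> carrier = {A \<in> mats F n. \<exists>B \<in> mats F n. mmult F n A B = mone F n \<and> mmult F n B A = mone F n},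
             monoid.mult = mmult F n, one = mone F n \<rparr>"

definition proj_grp :: "nat ring \<Rightarrow> nat \<Rightarrow> (nat \<Rightarrow> nat \<Rightarrow> nat) set \<Rightarrow> (nat \<Rightarrow> nat \<Rightarrow> nat) set monoid" where
  "proj_grp F n H = (GL F n)\<lparr>carrier := H\<rparr> Mod center ((GL F n)\<lparr>carrier := H\<rparr>)"

definition SL :: "nat ring \<Rightarrow> nat \<Rightarrow> (nat \<Rightarrow> nat \<Rightarrow> nat) set" where
  "SL F m = {A \<in> carrier (GL F m). mdet F m A = \<one>\<^bsub>F\<^esub>}"

definition PSL :: "nat ring \<Rightarrow> nat \<Rightarrow> (nat \<Rightarrow> nat \<Rightarrow> nat) set monoid" where
  "PSL F m = proj_grp F m (SL F m)"

subsection \<open>2A_n(q) = PSU_{n+1}(q); here F is the field of order q^2, with involution x -> x^q\<close>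

definition SU :: "nat ring \<Rightarrow> nat \<Rightarrow> nat \<Rightarrow> (nat \<Rightarrow> nat \<Rightarrow> nat) set" where
  "SU F q m = {A \<in> SL F m.
      mmult F m A (\<lambda>i j. if i < m \<and> j < m then A j i [^]\<^bsub>F\<^esub> q else 0) = mone F m}"

definition PSU :: "nat ring \<Rightarrow> nat \<Rightarrow> nat \<Rightarrow> (nat \<Rightarrow> nat \<Rightarrow> nat) set monoid" where
  "PSU F q m = proj_grp F m (SU F q m)"

definition quadD :: "nat ring \<Rightarrow> nat \<Rightarrow> (nat \<Rightarrow> nat) \<Rightarrow> nat" where
  "quadD F n x = (\<Oplus>\<^bsub>F\<^esub> i \<in> {..<n}. x i \<otimes>\<^bsub>F\<^esub> x (n + i))"

definition OplusGrp :: "nat ring \<Rightarrow> nat \<Rightarrow> (nat \<Rightarrow> nat \<Rightarrow> nat) set" where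
  "OplusGrp F n = {A \<in> carrier (GL F (2 * n)).
      \<forall>x \<in> vecs F (2 * n). quadD F n (mvec F (2 * n) A x) = quadD F n x}"

definition OmegaPlus :: "nat ring \<Rightarrow> nat \<Rightarrow> (nat \<Rightarrow> nat \<Rightarrow> nat) set" where
  "OmegaPlus F n = derived (GL F (2 * n)) (OplusGrp F n)"

definition POmegaPlus :: "nat ring \<Rightarrow> nat \<Rightarrow> (nat \<Rightarrow> nat \<Rightarrow> nat) set monoid" where
  "POmegaPlus F n = proj_grp F (2 * n) (OmegaPlus F n)"

text \<open>Dickson's cubic form on the 27-dimensional space F^27 = M_3(F)^3 (split Albert algebra):
  N(a,b,c) = det a + det b + det c - tr(abc), where coordinates 0..8, 9..17, 18..26
  hold a, b, c respectively (row-major).\<close>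
definition blk :: "(nat \<Rightarrow> nat) \<Rightarrow> nat \<Rightarrow> (nat \<Rightarrow> nat \<Rightarrow> nat)" where
  "blk x t = (\<lambda>i j. if i < 3 \<and> j < 3 then x (9 * t + 3 * i + j) else 0)"

definition cubicE6 :: "nat ring \<Rightarrow> (nat \<Rightarrow> nat) \<Rightarrow> nat" where
  "cubicE6 F x =
     mdet F 3 (blk x 0) \<oplus>\<^bsub>F\<^esub> mdet F 3 (blk x 1) \<oplus>\<^bsub>F\<^esub> mdet F 3 (blk x 2) \<oplus>\<^bsub>F\<^esub>
     \<ominus>\<^bsub>F\<^esub> (\<Oplus>\<^bsub>F\<^esub> i \<in> {..<3}. \<Oplus>\<^bsub>F\<^esub> j \<in> {..<3}. \<Oplus>\<^bsub>F\<^esub> k \<in> {..<3}.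
            blk x 0 i j \<otimes>\<^bsub>F\<^esub> blk x 1 j k \<otimes>\<^bsub>F\<^esub> blk x 2 k i)"

definition IsomE6 :: "nat ring \<Rightarrow> (nat \<Rightarrow> nat \<Rightarrow> nat) set" where
  "IsomE6 F = {A \<in> carrier (GL F 27). \<forall>x \<in> vecs F 27. cubicE6 F (mvec F 27 A x) = cubicE6 F x}"

definition E6grp :: "nat ring \<Rightarrow> (nat \<Rightarrow> nat \<Rightarrow> nat) set monoid" where
  "E6grp F = proj_grp F 27 (derived (GL F 27) (IsomE6 F))"

definition finite_field :: "nat ring \<Rightarrow> bool" where
  "finite_field F \<longleftrightarrow> field F \<and> finite (carrier F)"

definition excluded_simple :: "('a, 'b) monoid_scheme \<Rightarrow> bool" where
  "excluded_simple S \<longleftrightarrow>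
     (\<exists>F n. finite_field F \<and> n + 1 > 2 \<and> S \<cong> PSL F (n + 1))
   \<or> (\<exists>F n. finite_field F \<and> n \<ge> 4 \<and> (n = 4 \<or> even (card (carrier F))) \<and> S \<cong> POmegaPlus F n)
   \<or> (\<exists>F. finite_field F \<and> S \<cong> E6grp F)
   \<or> (\<exists>F q n. finite_field F \<and> card (carrier F) = q ^ 2 \<and> n > 1 \<and> S \<cong> PSU F q (n + 1))"

end

theory Submission
  imports Defs
begin

text \<open>
  The point is that \<open>m\<^bsub>G,N\<^esub> = 0\<close> whenever \<open>G / N\<close> is soluble and \<open>G\<close> is not.

  Let \<open>L \<subseteq> N\<close> be the soluble residual of \<open>G\<close>, let \<open>M\<close> be maximal among the normal subgroups of \<open>G\<close> properly
  contained in \<open>L\<close>, and let \<open>C\<close> be the centralizer of \<open>L / M\<close>. By transitivity of \<open>m\<close> it suffices that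
  the sum of \<open>|Z| \<mu>(Z,G)\<close> over \<open>M \<subseteq> Z\<close>, \<open>Z L = G\<close> vanishes. Solubility of \<open>G / L\<close> forces \<open>U C \<noteq> G\<close> for every proper
  supplement \<open>U \<supseteq> M\<close> of \<open>L\<close>, whence \<open>\<mu>(Z,G) = 0\<close> unless \<open>C \<subseteq> Z\<close>.

  By a theorem of Weisner, for a proper subgroup \<open>U\<close> of \<open>G\<close> and any function \<open>f\<close> the sum of \<open>f(Z \<inter> U) \<mu>(Z,G)\<close> over all
  \<open>Z\<close> is zero. So it is enough to write \<open>|Z \<inter> L|\<close>, for the supplements \<open>Z\<close> in question, as a sum of terms
  each of which depends on \<open>Z \<inter> U\<close> only, for some \<open>U \<noteq> G\<close>. If \<open>C L \<noteq> G\<close>, then \<open>G / C L\<close> has a nontrivial normal \<open>r\<close>-subgroup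
  \<open>H / C L\<close> for some prime \<open>r\<close>. The Sylow \<open>r\<close>-subgroups \<open>R / C\<close> of \<open>(Z \<inter> H) / C\<close> are permuted transitively by \<open>Z \<inter> L\<close>,
  so \<open>|Z \<inter> L|\<close> is the sum of the \<open>|Z \<inter> L \<inter> N\<^sub>G(R)|\<close>. Since a subgroup of \<open>r\<close>-power order is Sylow if and only if it is
  Sylow in its normalizer, the term of \<open>R\<close> depends on \<open>Z \<inter> N\<^sub>G(R)\<close> only, and \<open>N\<^sub>G(R) \<noteq> G\<close> because \<open>G / C\<close> has no
  nontrivial normal \<open>r\<close>-subgroup. If \<open>C L = G\<close>, count the elements of \<open>Z\<close> instead, using that \<open>G / C\<close> is not cyclic.
\<close>

subsection \<open>Moebius sums over supplements\<close>

text \<open>Each recursive call passes to a strictly larger member of \<open>P\<close>, so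
  \<open>card (T - Z)\<close> drops every time and bounds the depth that is ever used.\<close>

lemma mob_aux_stable:
  assumes "finite T" "P \<subseteq> Pow T" "Z \<subseteq> T" "card (T - Z) \<le> k" "card (T - Z) \<le> k'"
  shows "mob_aux k P T Z = mob_aux k' P T Z"
  using assms(3-)
proof (induction "card (T - Z)" arbitrary: Z k k' rule: less_induct)
  case less
  show ?case
  proof (cases "Z = T")
    case True
    have "mob_aux i P T T = 1" for i by (cases i) simp_all
    then show ?thesis using True by simp
  next
    case False
    then have "T - Z \<noteq> {}" using less.prems by auto
    then have pos: "card (T - Z) > 0" using assms(1) by (simp add: card_gt_0_iff)
    obtain j j' where j: "k = Suc j" "k' = Suc j'"
      using pos less.prems(2,3) by (metis gr0_implies_Suc less_le_trans)
    have "mob_aux j P T Y = mob_aux j' P T Y" if "Y \<in> {Y \<in> P. Z \<subset> Y}" for Y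
    proof -
      have "T - Y \<subset> T - Z" using that less.prems(1) assms(2) by blast
      then have "card (T - Y) < card (T - Z)" using assms(1) by (simp add: psubset_card_mono)
      then show ?thesis using less.hyps[of Y j j'] that assms(2) less.prems j by auto
    qed
    then have "(\<Sum>Y \<in> {Y \<in> P. Z \<subset> Y}. mob_aux j P T Y) = (\<Sum>Y \<in> {Y \<in> P. Z \<subset> Y}. mob_aux j' P T Y)"
      by (rule sum.cong[OF refl])
    then show ?thesis using False j by simp
  qed
qed

locale fin_group = group +
  assumes fin: "finite (carrier G)"
begin

abbreviation \<mu> :: "'a set \<Rightarrow> int" where "\<mu> \<equiv> sub_mobius G"

lemma finite_sub: "subgroup H G \<Longrightarrow> finite H"
  using fin subgroup.subset finite_subset by metis

lemma finite_subgroups: "finite {Z. subgroup Z G \<and> Q Z}"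
  by (rule finite_subset[of _ "Pow (carrier G)"]) (auto simp: fin dest: subgroup.subset)

lemma card_sub_pos: "subgroup H G \<Longrightarrow> card H > 0"
  using finite_sub subgroup.one_closed card_gt_0_iff by blast

lemma sub_mobius_top: "\<mu> (carrier G) = 1"
  unfolding sub_mobius_def by (cases "card (carrier G)") simp_all

lemma sub_mobius_rec:
  assumes "subgroup H G" "H \<noteq> carrier G"
  shows "\<mu> H = - (\<Sum>Y \<in> {Y. subgroup Y G \<and> H \<subset> Y}. \<mu> Y)"
proof -
  obtain j where j: "card (carrier G) = Suc j"
    using card_sub_pos[OF subgroup_self] gr0_implies_Suc by blast
  have "mob_aux j {Y. subgroup Y G} (carrier G) Y = \<mu> Y" if "Y \<in> {Y. subgroup Y G \<and> H \<subset> Y}" for Y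
    unfolding sub_mobius_def
  proof (rule mob_aux_stable)
    \<comment> \<open>Unfolding one level leaves depth |G| - 1, which still suffices because a
      subgroup is nonempty.\<close>
    have Y: "subgroup Y G" using that by auto
    then have "card (carrier G - Y) = card (carrier G) - card Y"
      by (simp add: card_Diff_subset finite_sub subgroup.subset)
    then show "card (carrier G - Y) \<le> j" using card_sub_pos[OF Y] j by linarith
    show "card (carrier G - Y) \<le> card (carrier G)" by (simp add: card_mono fin)
  qed (use that in \<open>auto simp: fin dest: subgroup.subset\<close>)
  then have "(\<Sum>Y \<in> {Y \<in> {Y. subgroup Y G}. H \<subset> Y}. mob_aux j {Y. subgroup Y G} (carrier G) Y)
      = (\<Sum>Y \<in> {Y. subgroup Y G \<and> H \<subset> Y}. \<mu> Y)"
    by (intro sum.cong) auto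
  moreover have "\<mu> H = - (\<Sum>Y \<in> {Y \<in> {Y. subgroup Y G}. H \<subset> Y}. mob_aux j {Y. subgroup Y G} (carrier G) Y)"
    unfolding sub_mobius_def j using assms by simp
  ultimately show ?thesis by linarith
qed

lemma sum_mobius_above:
  assumes "subgroup H G" "H \<noteq> carrier G"
  shows "(\<Sum>Z \<in> {Z. subgroup Z G \<and> H \<subseteq> Z}. \<mu> Z) = 0"
proof -
  have "{Z. subgroup Z G \<and> H \<subseteq> Z} = insert H {Z. subgroup Z G \<and> H \<subset> Z}" using assms by auto
  then have "sum \<mu> {Z. subgroup Z G \<and> H \<subseteq> Z} = \<mu> H + sum \<mu> {Z. subgroup Z G \<and> H \<subset> Z}"
    by (simp add: finite_subgroups)
  then show ?thesis using sub_mobius_rec[OF assms] by linarith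
qed

text \<open>The subgroups above \<open>W\<close> are grouped by their intersection \<open>V\<close>
  with \<open>H\<close>. Their total is zero since \<open>W\<close> is proper, and the groups with
  \<open>V\<close> larger than \<open>W\<close> vanish by induction. If \<open>W\<close> is not a
  subgroup of \<open>H\<close>, the sum is empty.\<close>

lemma weisner:
  assumes H: "subgroup H G" "H \<noteq> carrier G"
  shows "(\<Sum>Z \<in> {Z. subgroup Z G \<and> Z \<inter> H = W}. \<mu> Z) = 0"
proof (induction "card (H - W)" arbitrary: W rule: less_induct)
  case less
  show ?case
  proof (cases "subgroup W G \<and> W \<subseteq> H")
    case False
    then have e: "{Z. subgroup Z G \<and> Z \<inter> H = W} = {}"
      using H(1) subgroups_Inter_pair by blast
    show ?thesis unfolding e by simp
  next
    case True
    let ?S = "{Z. subgroup Z G \<and> W \<subseteq> Z}" and ?T = "{V. subgroup V G \<and> W \<subseteq> V \<and> V \<subseteq> H}"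
    have "W \<noteq> carrier G" using True H subgroup.subset by blast
    then have "0 = sum \<mu> ?S" using sum_mobius_above True by simp
    also have "\<dots> = (\<Sum>V\<in>?T. \<Sum>Z\<in>{Z\<in>?S. Z \<inter> H = V}. \<mu> Z)"
      by (rule sum.group[symmetric])
        (use True H(1) subgroups_Inter_pair in \<open>auto simp: finite_subgroups\<close>)
    also have "\<dots> = (\<Sum>V\<in>?T. \<Sum>Z\<in>{Z. subgroup Z G \<and> Z \<inter> H = V}. \<mu> Z)"
      by (intro sum.cong) auto
    also have "\<dots> = (\<Sum>Z\<in>{Z. subgroup Z G \<and> Z \<inter> H = W}. \<mu> Z) +
        (\<Sum>V\<in>?T - {W}. \<Sum>Z\<in>{Z. subgroup Z G \<and> Z \<inter> H = V}. \<mu> Z)"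
      by (rule sum.remove) (use True in \<open>auto simp: finite_subgroups\<close>)
    also have "(\<Sum>V\<in>?T - {W}. \<Sum>Z\<in>{Z. subgroup Z G \<and> Z \<inter> H = V}. \<mu> Z) = 0"
    proof (rule sum.neutral, rule)
      fix V assume "V \<in> ?T - {W}"
      then have "H - V \<subset> H - W" by auto
      then have "card (H - V) < card (H - W)"
        using finite_sub[OF H(1)] by (simp add: psubset_card_mono)
      then show "(\<Sum>Z\<in>{Z. subgroup Z G \<and> Z \<inter> H = V}. \<mu> Z) = 0" using less by blast
    qed
    finally show ?thesis by simp
  qed
qed

text \<open>The working form of Weisner's theorem: on each class of subgroups with the same
  intersection with \<open>H\<close> the weight \<open>f\<close> is constant.\<close>

lemma sum_local_eq_0:
  fixes f :: "'a set \<Rightarrow> int"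
  assumes H: "subgroup H G" "H \<noteq> carrier G"
  shows "(\<Sum>Z \<in> {Z. subgroup Z G}. f (Z \<inter> H) * \<mu> Z) = 0"
proof -
  have f: "finite {Z. subgroup Z G}" using finite_subgroups[of "\<lambda>_. True"] by simp
  have "(\<Sum>Z \<in> {Z. subgroup Z G}. f (Z \<inter> H) * \<mu> Z)
      = (\<Sum>W \<in> {Z. subgroup Z G}. \<Sum>Z\<in>{Z \<in> {Z. subgroup Z G}. Z \<inter> H = W}. f (Z \<inter> H) * \<mu> Z)"
    by (rule sum.group[symmetric]) (use H subgroups_Inter_pair f in auto)
  also have "\<dots> = (\<Sum>W \<in> {Z. subgroup Z G}. f W * (\<Sum>Z\<in>{Z. subgroup Z G \<and> Z \<inter> H = W}. \<mu> Z))"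
    by (intro sum.cong) (auto simp: sum_distrib_left intro!: sum.cong)
  also have "\<dots> = 0" using weisner[OF H] by simp
  finally show ?thesis .
qed

text \<open>Multiplied by \<open>1 / |G|\<close>, the case \<open>B = {\<one>}\<close> is \<open>m_GN G N\<close>; in general it is \<open>m_GN\<close> of the
  quotient by a normal subgroup \<open>B\<close>, computed inside \<open>G\<close>.\<close>

definition m_sum :: "'a set \<Rightarrow> 'a set \<Rightarrow> int" where
  "m_sum B N = (\<Sum>Z \<in> {Z. subgroup Z G \<and> B \<subseteq> Z \<and> Z <#> N = carrier G}. int (card Z) * \<mu> Z)"

lemma m_GN_eq_0_iff: "m_GN G N = 0 \<longleftrightarrow> m_sum {\<one>} N = 0"
proof -
  have "{Z. subgroup Z G \<and> {\<one>} \<subseteq> Z \<and> Z <#> N = carrier G} = {Z. subgroup Z G \<and> Z <#> N = carrier G}"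
    by (auto simp: subgroup.one_closed)
  then have "m_GN G N = (1 / of_nat (card (carrier G))) * of_int (m_sum {\<one>} N)"
    by (simp add: m_GN_def m_sum_def)
  then show ?thesis using card_sub_pos[OF subgroup_self] by simp
qed

section \<open>Products of subgroups\<close>

lemma set_mult_iff: "x \<in> H <#> K \<longleftrightarrow> (\<exists>h\<in>H. \<exists>k\<in>K. x = h \<otimes> k)"
  by (auto simp: set_mult_def)

lemma inv_cancel:
  assumes "x \<in> carrier G" "y \<in> carrier G"
  shows "inv x \<otimes> (x \<otimes> y) = y" "x \<otimes> (inv x \<otimes> y) = y"
  using assms by (simp_all flip: m_assoc)

text \<open>The factorizations of \<open>h \<otimes> k\<close> are exactly
  \<open>h \<otimes> d\<close> times \<open>inv d \<otimes> k\<close> with \<open>d\<close> in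
  \<open>H \<inter> K\<close>.\<close>

lemma coset_fibre:
  assumes H: "subgroup H G" and K: "subgroup K G" and hk: "h \<in> H" "k \<in> K"
  shows "card {p \<in> H \<times> K. fst p \<otimes> snd p = h \<otimes> k} = card (H \<inter> K)"
proof -
  interpret H: subgroup H G by fact
  interpret K: subgroup K G by fact
  let ?f = "\<lambda>d. (h \<otimes> d, inv d \<otimes> k)"
  have c: "h \<in> carrier G" "k \<in> carrier G" using hk by simp_all
  have "inj_on ?f (H \<inter> K)" using c by (auto intro!: inj_onI)
  then have "card (?f ` (H \<inter> K)) = card (H \<inter> K)" by (rule card_image)
  moreover have "?f ` (H \<inter> K) = {p \<in> H \<times> K. fst p \<otimes> snd p = h \<otimes> k}"
  proof (intro equalityI subsetI)
    fix p assume "p \<in> ?f ` (H \<inter> K)"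
    then obtain d where d: "d \<in> H" "d \<in> K" "p = ?f d" by blast
    have "h \<otimes> d \<otimes> (inv d \<otimes> k) = h \<otimes> k" using c d by (simp add: m_assoc inv_cancel)
    then show "p \<in> {p \<in> H \<times> K. fst p \<otimes> snd p = h \<otimes> k}" using d hk by simp
  next
    fix p assume "p \<in> {p \<in> H \<times> K. fst p \<otimes> snd p = h \<otimes> k}"
    then obtain a b where ab: "p = (a, b)" "a \<in> H" "b \<in> K" "a \<otimes> b = h \<otimes> k" by force
    define d where "d = inv h \<otimes> a"
    have "b = inv a \<otimes> (h \<otimes> k)" using ab inv_cancel(1)[of a b] by simp
    then have b: "b = inv d \<otimes> k" using ab c by (simp add: d_def inv_mult_group m_assoc)
    have "d = k \<otimes> inv b" using b c ab unfolding b d_def by (simp add: inv_mult_group inv_cancel)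
    then have "d \<in> K" using ab hk by simp
    moreover have "d \<in> H" using ab hk by (simp add: d_def)
    moreover have "a = h \<otimes> d" using ab c by (simp add: d_def inv_cancel)
    ultimately show "p \<in> ?f ` (H \<inter> K)" using ab b by blast
  qed
  ultimately show ?thesis by (simp only:)
qed

text \<open>The pairs in \<open>H \<times> K\<close> are counted by their product; all fibres have
  the same size.\<close>

lemma card_set_mult:
  assumes H: "subgroup H G" and K: "subgroup K G"
  shows "card (H <#> K) * card (H \<inter> K) = card H * card K"
proof -
  interpret H: subgroup H G by fact
  interpret K: subgroup K G by fact
  have "card (H \<times> K) = (\<Sum>y\<in>H <#> K. card {p \<in> H \<times> K. fst p \<otimes> snd p = y})"
  proof -
    have "(\<Sum>y\<in>H <#> K. \<Sum>p\<in>{p \<in> H \<times> K. fst p \<otimes> snd p = y}. (1::nat)) = (\<Sum>p\<in>H \<times> K. 1)"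
    proof (rule sum.group)
      show "finite (H <#> K)"
        by (rule finite_subset[OF set_mult_closed[OF H.subset K.subset] fin])
    qed (use H K finite_sub in \<open>auto simp: set_mult_def\<close>)
    then show ?thesis by simp
  qed
  also have "\<dots> = (\<Sum>y\<in>H <#> K. card (H \<inter> K))"
    by (rule sum.cong) (auto simp: set_mult_def coset_fibre[OF H K])
  finally show ?thesis by (simp add: card_cartesian_product)
qed

text \<open>Dedekind's modular law: if \<open>z \<otimes> l\<close> lies in \<open>Y\<close>, so
  does \<open>z\<close>, because \<open>l\<close> does.\<close>

lemma dedekind:
  assumes Y: "subgroup Y G" and "Z \<subseteq> carrier G" "L \<subseteq> Y"
  shows "(Z <#> L) \<inter> Y = (Z \<inter> Y) <#> L"
proof -
  interpret Y: subgroup Y G by fact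
  have "z \<in> Y" if "z \<in> Z" "l \<in> L" "z \<otimes> l \<in> Y" for z l
  proof -
    have "z \<otimes> l \<otimes> inv l \<in> Y" using that assms by auto
    then show ?thesis using that assms Y.subset by (simp add: m_assoc subset_iff)
  qed
  then have "x \<in> (Z <#> L) \<inter> Y \<longleftrightarrow> x \<in> (Z \<inter> Y) <#> L" for x
    unfolding set_mult_iff Int_iff Bex_def using assms(3) Y.m_closed by blast
  then show ?thesis by blast
qed

lemma set_mult_subset_sub:
  assumes "subgroup H G" "A \<subseteq> H" "B \<subseteq> H"
  shows "A <#> B \<subseteq> H"
  using assms subgroup.m_closed[OF assms(1)] unfolding set_mult_def by blast

lemma set_mult_normal_subgroup:
  assumes "subgroup Z G" "N \<lhd> G"
  shows "subgroup (Z <#> N) G"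
  using mult_norm_subgroup[OF assms(2,1)] commut_normal[OF assms] by simp

lemma subset_set_mult:
  assumes "subgroup H G" "subgroup K G"
  shows "H \<subseteq> H <#> K" "K \<subseteq> H <#> K"
proof -
  interpret H: subgroup H G by fact
  interpret K: subgroup K G by fact
  have "h = h \<otimes> \<one>" if "h \<in> H" for h using that by simp
  then show "H \<subseteq> H <#> K" unfolding set_mult_def using K.one_closed by blast
  have "k = \<one> \<otimes> k" if "k \<in> K" for k using that by simp
  then show "K \<subseteq> H <#> K" unfolding set_mult_def using H.one_closed by blast
qed

lemma set_mult_absorb:
  assumes "subgroup H G" "K \<subseteq> H" "\<one> \<in> K"
  shows "H <#> K = H" "K <#> H = H"
proof -
  interpret H: subgroup H G by fact
  have "h = h \<otimes> \<one>" if "h \<in> H" for h using that by simp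
  then have "H \<subseteq> H <#> K" unfolding set_mult_def using assms(3) by blast
  then show "H <#> K = H" using set_mult_subset_sub[OF assms(1) subset_refl assms(2)] by blast
  have "k = \<one> \<otimes> k" if "k \<in> H" for k using that by simp
  then have "H \<subseteq> K <#> H" unfolding set_mult_def using assms(3) by blast
  then show "K <#> H = H" using set_mult_subset_sub[OF assms(1) assms(2) subset_refl] by blast
qed

text \<open>The transitivity \<open>m\<^bsub>G/B,N/B\<^esub> = m\<^bsub>G/B,L/B\<^esub> m\<^bsub>G/L,N/L\<^esub>\<close>: for \<open>Y \<supseteq> L\<close> the partial sum
  over \<open>Z L = Y\<close> is proportional to \<open>\<mu> Y\<close>, as it satisfies the recursion of \<open>\<mu>\<close>.\<close>

lemma m_sum_mult:
  assumes L: "L \<lhd> G" and N: "N \<lhd> G" and BL: "B \<subseteq> L" and LN: "L \<subseteq> N"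
  shows "int (card (carrier G)) * m_sum B N = m_sum B L * m_sum L N"
proof -
  interpret L: normal L G by fact
  interpret N: normal N G by fact
  define F where "F Y = {Z. subgroup Z G \<and> B \<subseteq> Z \<and> Z <#> L = Y}" for Y
  \<comment> \<open>By the product formula the weight \<open>card (Z \<inter> L)\<close> is
    proportional to \<open>card Z\<close> on \<open>F Y\<close>; for \<open>L \<subseteq> Y\<close>
    it depends on \<open>Z \<inter> Y\<close> only.\<close>
  define h where "h Y = (\<Sum>Z\<in>F Y. int (card (Z \<inter> L)) * \<mu> Z)" for Y
  have finF: "finite (F Y)" for Y unfolding F_def by (rule finite_subgroups)
  have ZL: "int (card L) * int (card Z) = int (card Y) * int (card (Z \<inter> L))" if "Z \<in> F Y" for Y Z
  proof -
    have "card Y * card (Z \<inter> L) = card Z * card L"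
      using that card_set_mult[of Z L] L.subgroup_axioms by (auto simp: F_def)
    then show ?thesis by (simp only: of_nat_mult[symmetric] mult.commute)
  qed
  have ZLN: "Z <#> L <#> N = Z <#> N" if "subgroup Z G" for Z
    using set_mult_assoc[OF subgroup.subset[OF that] L.subset N.subset]
      set_mult_absorb(2)[OF N.subgroup_axioms LN L.one_closed] by simp
  have h: "h Y = h (carrier G) * \<mu> Y" if "subgroup Y G" "L \<subseteq> Y" for Y
    using that
  proof (induction "card (carrier G - Y)" arbitrary: Y rule: less_induct)
    case less
    show ?case
    proof (cases "Y = carrier G")
      case True
      then show ?thesis using sub_mobius_top by simp
    next
      case False
      let ?S = "{Z. subgroup Z G \<and> B \<subseteq> Z \<and> Y \<subseteq> Z <#> L}"
      let ?T = "{V. subgroup V G \<and> Y \<subseteq> V}"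
      \<comment> \<open>By Dedekind's law \<open>(Z \<inter> Y) <#> L = Y\<close> holds exactly when
        \<open>Y \<subseteq> Z <#> L\<close>. So the total of \<open>h\<close> over the subgroups
        above \<open>Y\<close> has a weight depending on \<open>Z \<inter> Y\<close> only, and
        Weisner's theorem makes it vanish.\<close>
      let ?f = "\<lambda>W. if B \<subseteq> W \<and> W <#> L = Y then int (card (W \<inter> L)) else 0"
      have "(\<Sum>V\<in>?T. h V) = (\<Sum>V\<in>?T. \<Sum>Z\<in>{Z\<in>?S. Z <#> L = V}. int (card (Z \<inter> L)) * \<mu> Z)"
        unfolding h_def F_def by (intro sum.cong) auto
      also have "\<dots> = (\<Sum>Z\<in>?S. int (card (Z \<inter> L)) * \<mu> Z)"
        by (rule sum.group) (use set_mult_normal_subgroup[OF _ L] in \<open>auto simp: finite_subgroups\<close>)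
      also have "\<dots> = (\<Sum>Z\<in>{Z. subgroup Z G}. ?f (Z \<inter> Y) * \<mu> Z)"
      proof (rule sum.mono_neutral_cong_left)
        show "finite {Z. subgroup Z G}" using finite_subgroups[of "\<lambda>_. True"] by simp
        have eq: "B \<subseteq> Z \<inter> Y \<and> (Z \<inter> Y) <#> L = Y \<longleftrightarrow> B \<subseteq> Z \<and> Y \<subseteq> Z <#> L" if "subgroup Z G" for Z
          using dedekind[OF less.prems(1) subgroup.subset[OF that] less.prems(2)] less.prems(2) BL
          by blast
        have YL: "Z \<inter> Y \<inter> L = Z \<inter> L" for Z using less.prems by auto
        show "int (card (Z \<inter> L)) * \<mu> Z = ?f (Z \<inter> Y) * \<mu> Z" if "Z \<in> ?S" for Z
        proof -
          have "B \<subseteq> Z \<inter> Y \<and> (Z \<inter> Y) <#> L = Y" using eq that by blast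
          then show ?thesis unfolding YL by simp
        qed
        show "\<forall>Z\<in>{Z. subgroup Z G} - ?S. ?f (Z \<inter> Y) * \<mu> Z = 0"
        proof
          fix Z assume Z: "Z \<in> {Z. subgroup Z G} - ?S"
          then have "\<not> (B \<subseteq> Z \<inter> Y \<and> (Z \<inter> Y) <#> L = Y)" using eq by blast
          then show "?f (Z \<inter> Y) * \<mu> Z = 0" by (simp only: if_False)
        qed
      qed auto
      also have "\<dots> = 0" by (rule sum_local_eq_0[OF less.prems(1) False])
      finally have *: "(\<Sum>V\<in>?T. h V) = 0" .
      have Y: "Y \<in> ?T" using less.prems by auto
      have "(\<Sum>V\<in>?T - {Y}. h V) = (\<Sum>V\<in>?T - {Y}. h (carrier G) * \<mu> V)"
      proof (rule sum.cong[OF refl])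
        fix V assume V: "V \<in> ?T - {Y}"
        then have "carrier G - V \<subset> carrier G - Y" using less.prems subgroup.subset by blast
        then have "card (carrier G - V) < card (carrier G - Y)" using fin by (simp add: psubset_card_mono)
        moreover have "subgroup V G" "L \<subseteq> V" using V less.prems by auto
        ultimately show "h V = h (carrier G) * \<mu> V" using less.hyps by blast
      qed
      also have "\<dots> = h (carrier G) * (\<Sum>V\<in>?T - {Y}. \<mu> V)" by (simp add: sum_distrib_left)
      also have "(\<Sum>V\<in>?T - {Y}. \<mu> V) = - \<mu> Y"
        using sum_mobius_above[OF less.prems(1) False] sum.remove[OF finite_subgroups Y, of \<mu>] by linarith
      finally show ?thesis
        using * sum.remove[OF finite_subgroups Y, of h] by linarith
    qed
  qed
  have "int (card L) * m_sum B N = (\<Sum>Z\<in>{Z. subgroup Z G \<and> B \<subseteq> Z \<and> Z <#> N = carrier G}. int (card L) * int (card Z) * \<mu> Z)"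
    by (simp add: m_sum_def sum_distrib_left mult.assoc)
  \<comment> \<open>The supplements \<open>Z\<close> of \<open>N\<close> are grouped by
    \<open>Y = Z <#> L\<close>; as \<open>L \<subseteq> N\<close>, \<open>Z\<close> supplements
    \<open>N\<close> if and only if \<open>Y\<close> does.\<close>
  also have "\<dots> = (\<Sum>Y\<in>{Y. subgroup Y G \<and> L \<subseteq> Y \<and> Y <#> N = carrier G}.
      \<Sum>Z\<in>{Z\<in>{Z. subgroup Z G \<and> B \<subseteq> Z \<and> Z <#> N = carrier G}. Z <#> L = Y}. int (card L) * int (card Z) * \<mu> Z)"
  proof (rule sum.group[symmetric])
    show "(\<lambda>Z. Z <#> L) ` {Z. subgroup Z G \<and> B \<subseteq> Z \<and> Z <#> N = carrier G}
       \<subseteq> {Y. subgroup Y G \<and> L \<subseteq> Y \<and> Y <#> N = carrier G}"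
    proof clarify
      fix Z assume Z: "subgroup Z G" "Z <#> N = carrier G"
      show "subgroup (Z <#> L) G \<and> L \<subseteq> Z <#> L \<and> Z <#> L <#> N = carrier G"
        using set_mult_normal_subgroup[OF Z(1) L] subset_set_mult(2)[OF Z(1) L.subgroup_axioms] ZLN[OF Z(1)] Z(2)
        by metis
    qed
  qed (simp_all add: finite_subgroups)
  also have "\<dots> = (\<Sum>Y\<in>{Y. subgroup Y G \<and> L \<subseteq> Y \<and> Y <#> N = carrier G}. int (card Y) * h Y)"
  proof (rule sum.cong[OF refl])
    fix Y assume Y: "Y \<in> {Y. subgroup Y G \<and> L \<subseteq> Y \<and> Y <#> N = carrier G}"
    then have "{Z\<in>{Z. subgroup Z G \<and> B \<subseteq> Z \<and> Z <#> N = carrier G}. Z <#> L = Y} = F Y"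
      unfolding F_def using ZLN by blast
    then show "(\<Sum>Z\<in>{Z\<in>{Z. subgroup Z G \<and> B \<subseteq> Z \<and> Z <#> N = carrier G}. Z <#> L = Y}. int (card L) * int (card Z) * \<mu> Z)
       = int (card Y) * h Y"
      unfolding h_def sum_distrib_left mult.assoc[symmetric]
      by (intro sum.cong arg_cong2[where f = "(*)"] refl ZL) simp_all
  qed
  also have "\<dots> = h (carrier G) * m_sum L N"
    unfolding m_sum_def sum_distrib_left
  proof (rule sum.cong[OF refl])
    fix Y assume "Y \<in> {Y. subgroup Y G \<and> L \<subseteq> Y \<and> Y <#> N = carrier G}"
    then have "h Y = h (carrier G) * \<mu> Y" using h by blast
    then show "int (card Y) * h Y = h (carrier G) * (int (card Y) * \<mu> Y)"
      by (metis mult.left_commute)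
  qed
  finally have 1: "int (card L) * m_sum B N = h (carrier G) * m_sum L N" .
  have "int (card L) * m_sum B L = (\<Sum>Z\<in>F (carrier G). int (card L) * int (card Z) * \<mu> Z)"
    by (simp add: m_sum_def F_def sum_distrib_left mult.assoc)
  also have "\<dots> = int (card (carrier G)) * h (carrier G)"
    unfolding h_def sum_distrib_left mult.assoc[symmetric]
    by (intro sum.cong arg_cong2[where f = "(*)"] refl ZL)
  finally have 2: "int (card L) * m_sum B L = int (card (carrier G)) * h (carrier G)" .
  have "int (card L) * (int (card (carrier G)) * m_sum B N) = int (card L) * (m_sum B L * m_sum L N)"
  proof -
    have "int (card L) * (int (card (carrier G)) * m_sum B N) = int (card (carrier G)) * (h (carrier G) * m_sum L N)"
      by (simp only: mult.left_commute[of _ "int (card (carrier G))"] 1)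
    also have "\<dots> = (int (card (carrier G)) * h (carrier G)) * m_sum L N" by (simp only: mult.assoc)
    also have "\<dots> = int (card L) * (m_sum B L * m_sum L N)" by (simp only: 2[symmetric] mult.assoc)
    finally show ?thesis .
  qed
  then show ?thesis using card_sub_pos[OF L.subgroup_axioms] by simp
qed

subsection \<open>Sylow subgroups modulo a normal subgroup\<close>

lemma card_sub_dvd:
  assumes H: "subgroup H G" and K: "subgroup K G" and "H \<subseteq> K"
  shows "card H dvd card K"
proof -
  have "card (rcosets\<^bsub>G\<lparr>carrier := K\<rparr>\<^esub> H) * card H = card K"
    using group.lagrange[OF subgroup_imp_group[OF K] subgroup_incl[OF assms]] by (simp add: order_def)
  then show ?thesis by (metis dvd_triv_right)
qed

text \<open>Stabilizers contain \<open>B\<close>, so orbit lengths divide the index of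
  \<open>B\<close> in \<open>A\<close>, a power of \<open>r\<close>. Hence \<open>r\<close> divides
  the length of every orbit that is not a fixed point.\<close>

lemma fixed_points_cong:
  fixes act :: "'a \<Rightarrow> 'e \<Rightarrow> 'e"
  assumes A: "subgroup A G" and B: "subgroup B G" "B \<subseteq> A" and r: "Factorial_Ring.prime (r::nat)"
    and card: "card A = card B * r ^ k" and E: "finite E"
    and cl: "\<And>g e. g \<in> A \<Longrightarrow> e \<in> E \<Longrightarrow> act g e \<in> E"
    and mul: "\<And>g h e. g \<in> A \<Longrightarrow> h \<in> A \<Longrightarrow> e \<in> E \<Longrightarrow> act (g \<otimes> h) e = act g (act h e)"
    and triv: "\<And>g e. g \<in> B \<Longrightarrow> e \<in> E \<Longrightarrow> act g e = e"
  shows "r dvd card E \<longleftrightarrow> r dvd card {e \<in> E. \<forall>g\<in>A. act g e = e}"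
proof -
  interpret A: subgroup A G by fact
  interpret B: subgroup B G by fact
  let ?A = "G\<lparr>carrier := A\<rparr>"
  interpret GA: group ?A by (rule A.subgroup_is_group[OF is_group])
  \<comment> \<open>The elements of \<open>BijGroup E\<close> are extensional functions, hence the
    restriction.\<close>
  let ?\<phi> = "\<lambda>g. restrict (act g) E"
  have one: "act \<one> e = e" if "e \<in> E" for e using triv[of \<one> e] that by simp
  have bij: "?\<phi> g \<in> Bij E" if g: "g \<in> A" for g
  proof -
    have "act (inv g) (act g e) = e" "act g (act (inv g) e) = e" if "e \<in> E" for e
      using mul[of "inv g" g e] mul[of g "inv g" e] that g by (simp_all add: one)
    then have "bij_betw (act g) E E"
      by (intro bij_betw_byWitness[where f' = "act (inv g)"]) (use cl g in auto)
    then show ?thesis by (simp add: Bij_def)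
  qed
  have "?\<phi> \<in> hom ?A (BijGroup E)"
  proof (rule homI)
    fix g h assume "g \<in> carrier ?A" "h \<in> carrier ?A"
    then have gh: "g \<in> A" "h \<in> A" by auto
    then have "?\<phi> (g \<otimes> h) = compose E (?\<phi> g) (?\<phi> h)"
      using mul cl by (auto simp: compose_def intro!: restrict_ext)
    then show "?\<phi> (g \<otimes>\<^bsub>?A\<^esub> h) = ?\<phi> g \<otimes>\<^bsub>BijGroup E\<^esub> ?\<phi> h"
      using bij gh by (simp add: BijGroup_def)
  qed (simp add: BijGroup_def bij)
  then interpret act: group_action ?A E ?\<phi>
    unfolding group_action_def group_hom_def group_hom_axioms_def
    using group_BijGroup GA.is_group by blast
  let ?F = "{e \<in> E. \<forall>g\<in>A. act g e = e}"
  let ?OO = "{Ob \<in> orbits ?A E ?\<phi>. \<not> Ob \<subseteq> ?F}"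
  have orb: "orbit ?A ?\<phi> e = {act g e | g. g \<in> A}" if "e \<in> E" for e
    using that by (auto simp: orbit_def)
  have div: "r dvd card Ob" if Ob: "Ob \<in> ?OO" for Ob
  proof -
    obtain e where e: "e \<in> E" "Ob = orbit ?A ?\<phi> e" using Ob by (auto simp: orbits_def)
    let ?S = "stabilizer ?A ?\<phi> e"
    have S: "subgroup ?S ?A" by (rule act.stabilizer_subgroup[OF e(1)])
    have "B \<subseteq> ?S" using triv e B by (auto simp: stabilizer_def)
    then have "card B dvd card ?S"
      using card_sub_dvd[OF B(1) incl_subgroup[OF A S]] by blast
    then obtain m where m: "card ?S = card B * m" by blast
    have "card Ob * card ?S = card A"
      using act.orbit_stabilizer_theorem[OF e(1)] e(2) by (simp add: order_def)
    then have "card Ob * m = r ^ k"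
      using card m card_sub_pos[OF B(1)] by (simp add: mult.left_commute)
    then have "card Ob dvd r ^ k" by (metis dvd_triv_left)
    then obtain i where i: "card Ob = r ^ i" using r divides_primepow_nat by blast
    have "i \<noteq> 0"
    proof
      assume "i = 0"
      then have "card Ob = 1" using i by simp
      moreover have "e \<in> Ob" using act.orbit_refl[OF e(1)] e(2) by (simp only:)
      ultimately have sing: "Ob = {e}" unfolding One_nat_def[symmetric] by (elim card_1_singletonE) simp
      have "act g e = e" if "g \<in> A" for g using that sing e orb[OF e(1)] by blast
      then have "Ob \<subseteq> ?F" using sing e by blast
      then show False using Ob by blast
    qed
    then show ?thesis using i by (simp add: dvd_power)
  qed
  have U: "E - ?F = \<Union>?OO"
  proof (intro equalityI subsetI)
    fix e assume e: "e \<in> E - ?F"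
    have "e \<in> orbit ?A ?\<phi> e" using act.orbit_refl e by blast
    moreover have "orbit ?A ?\<phi> e \<in> orbits ?A E ?\<phi>" using e by (auto simp: orbits_def)
    ultimately show "e \<in> \<Union>?OO" using e by blast
  next
    fix e assume "e \<in> \<Union>?OO"
    then obtain Ob where Ob: "Ob \<in> ?OO" "e \<in> Ob" by blast
    then obtain d where d: "d \<in> E" "Ob = orbit ?A ?\<phi> d" by (auto simp: orbits_def)
    have eE: "e \<in> E" using Ob act.orbits_coverture by blast
    have "e \<notin> ?F"
    proof
      assume e: "e \<in> ?F"
      have "d \<in> orbit ?A ?\<phi> e" using act.orbit_sym[OF d(1) eE] Ob d by blast
      then have "d = e" using orb[OF eE] e by auto
      have "orbit ?A ?\<phi> e \<subseteq> {e}" using orb[OF eE] e by auto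
      then have sing_orb: "orbit ?A ?\<phi> e = {e}" using act.orbit_refl[OF eE] by blast
      with \<open>d = e\<close> have "Ob = {e}" using d(2) by simp
      then show False using Ob e by blast
    qed
    then show "e \<in> E - ?F" using eE by blast
  qed
  have "r dvd card (\<Union>?OO)"
  proof (rule dvd_partition)
    show "finite (\<Union>?OO)" using E U by (simp only: U[symmetric] finite_Diff)
    show "\<forall>O1\<in>?OO. \<forall>O2\<in>?OO. O1 \<noteq> O2 \<longrightarrow> O1 \<inter> O2 = {}" using act.disjoint_union by blast
  qed (use div in blast)
  then have "r dvd card E - card ?F"
    unfolding U[symmetric] using E by (simp add: card_Diff_subset)
  moreover have "card ?F \<le> card E" using E by (intro card_mono) auto
  ultimately show ?thesis using dvd_diffD[of r "card E" "card ?F"] dvd_diff_nat[of r "card E" "card ?F"] dvd_diffD1[of r "card E" "card ?F"] by blast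
qed

section \<open>Conjugates and normalizers\<close>

definition cj :: "'a \<Rightarrow> 'a set \<Rightarrow> 'a set" where
  "cj g R = (\<lambda>x. g \<otimes> x \<otimes> inv g) ` R"

definition nrm :: "'a set \<Rightarrow> 'a set" where
  "nrm R = {g \<in> carrier G. cj g R = R}"

lemma cj_mult:
  assumes "g \<in> carrier G" "h \<in> carrier G" "R \<subseteq> carrier G"
  shows "cj (g \<otimes> h) R = cj g (cj h R)"
proof -
  have "g \<otimes> h \<otimes> x \<otimes> inv (g \<otimes> h) = g \<otimes> (h \<otimes> x \<otimes> inv h) \<otimes> inv g" if "x \<in> R" for x
    using that assms subsetD[OF assms(3) that] by (simp add: m_assoc inv_mult_group)
  then show ?thesis by (simp add: cj_def image_image)
qed

lemma cj_one: "R \<subseteq> carrier G \<Longrightarrow> cj \<one> R = R"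
  by (auto simp: cj_def subset_iff image_iff)

lemma cj_carrier: "g \<in> carrier G \<Longrightarrow> R \<subseteq> carrier G \<Longrightarrow> cj g R \<subseteq> carrier G"
  by (auto simp: cj_def subset_iff)

lemma cj_inv_eq:
  assumes "g \<in> carrier G" "R \<subseteq> carrier G"
  shows "cj (inv g) (cj g R) = R" "cj g (cj (inv g) R) = R"
  using cj_mult[of "inv g" g R] cj_mult[of g "inv g" R] assms by (simp_all add: cj_one)

lemma card_cj:
  assumes "g \<in> carrier G" "R \<subseteq> carrier G"
  shows "card (cj g R) = card R"
  unfolding cj_def
proof (intro card_image inj_onI)
  fix x y assume "x \<in> R" "y \<in> R" "g \<otimes> x \<otimes> inv g = g \<otimes> y \<otimes> inv g"
  then show "x = y" using conjugation_is_inj[OF assms(1)] assms(2) by blast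
qed

lemma cj_subgroup:
  assumes g: "g \<in> carrier G" and R: "subgroup R G"
  shows "subgroup (cj g R) G"
proof -
  interpret R: subgroup R G by fact
  have m: "(g \<otimes> x \<otimes> inv g) \<otimes> (g \<otimes> y \<otimes> inv g) = g \<otimes> (x \<otimes> y) \<otimes> inv g"
    and i: "inv (g \<otimes> x \<otimes> inv g) = g \<otimes> inv x \<otimes> inv g" if "x \<in> R" "y \<in> R" for x y
    using g that by (simp_all add: m_assoc inv_cancel inv_mult_group)
  show ?thesis
  proof (rule subgroupI)
    show "cj g R \<subseteq> carrier G" using cj_carrier[OF g R.subset] .
    show "cj g R \<noteq> {}" using R.one_closed unfolding cj_def by blast
    show "inv a \<in> cj g R" if "a \<in> cj g R" for a
      using that i by (auto simp: cj_def)
    show "a \<otimes> b \<in> cj g R" if "a \<in> cj g R" "b \<in> cj g R" for a b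
      using that m by (auto simp: cj_def)
  qed
qed

text \<open>Conjugation preserves the finite order of \<open>R\<close>, so inclusion forces
  equality.\<close>

lemma cj_subset_eq:
  assumes "g \<in> carrier G" "subgroup R G" "cj g R \<subseteq> R"
  shows "cj g R = R"
  using card_subset_eq[OF finite_sub[OF assms(2)] assms(3)] card_cj[OF assms(1) subgroup.subset[OF assms(2)]] .

lemma cj_self:
  assumes "subgroup R G" "g \<in> R"
  shows "cj g R = R"
proof (rule cj_subset_eq)
  interpret R: subgroup R G by fact
  show "g \<in> carrier G" using assms by simp
  show "cj g R \<subseteq> R" using assms(2) by (auto simp: cj_def)
qed fact

lemma cj_normal:
  assumes "N \<lhd> G" "g \<in> carrier G"
  shows "cj g N = N"
  using assms normal_invE[OF assms(1)] by (intro cj_subset_eq) (auto simp: cj_def)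

lemma cj_mono: "A \<subseteq> B \<Longrightarrow> cj g A \<subseteq> cj g B"
  by (auto simp: cj_def)

lemma nrm_carrier_imp_normal:
  assumes "subgroup R G" "nrm R = carrier G"
  shows "R \<lhd> G"
proof (rule normal_invI[OF assms(1)])
  fix x h assume "x \<in> carrier G" "h \<in> R"
  then have "x \<in> nrm R" "h \<in> R" using assms(2) by auto
  then show "x \<otimes> h \<otimes> inv x \<in> R" by (auto simp: nrm_def cj_def)
qed

lemma nrm_subgroup:
  assumes R: "R \<subseteq> carrier G"
  shows "subgroup (nrm R) G"
proof (rule subgroupI)
  show "nrm R \<noteq> {}" using cj_one[OF R] by (auto simp: nrm_def)
  show "inv a \<in> nrm R" if "a \<in> nrm R" for a
    using that cj_inv_eq(1)[of a R] R by (auto simp: nrm_def)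
  show "a \<otimes> b \<in> nrm R" if "a \<in> nrm R" "b \<in> nrm R" for a b
    using that cj_mult[of a b R] R by (auto simp: nrm_def)
qed (auto simp: nrm_def)

section \<open>The action on right cosets\<close>

lemma rcos_eq_iff:
  assumes R: "subgroup R G" and x: "x \<in> carrier G" and y: "y \<in> carrier G"
  shows "R #> x = R #> y \<longleftrightarrow> x \<otimes> inv y \<in> R"
proof
  assume "R #> x = R #> y"
  then have "x \<in> R #> y" using rcos_self[OF x R] by simp
  then show "x \<otimes> inv y \<in> R" by (rule subgroup.rcos_module_imp[OF R is_group y])
next
  assume "x \<otimes> inv y \<in> R"
  then have "x \<in> R #> y" by (rule subgroup.rcos_module_rev[OF R is_group y x])
  then show "R #> x = R #> y" using repr_independence[OF _ y R] by simp
qed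

lemma card_rcosets_sub:
  assumes "subgroup R G" "subgroup K G" "R \<subseteq> K"
  shows "card ((\<lambda>x. R #> x) ` K) * card R = card K"
proof -
  have "(\<lambda>x. R #> x) ` K = rcosets\<^bsub>G\<lparr>carrier := K\<rparr>\<^esub> R"
    by (auto simp: RCOSETS_def)
  then show ?thesis
    using group.lagrange[OF subgroup_imp_group[OF assms(2)] subgroup_incl[OF assms]] by (simp add: order_def)
qed

text \<open>Multiplying on the right by \<open>inv h\<close> makes this a left action; it fixes
  \<open>R #> x\<close> exactly if \<open>x \<otimes> inv h \<otimes> inv x\<close> is in
  \<open>R\<close>.\<close>

lemma rcos_fixed_iff:
  assumes R: "subgroup R G" and Q: "subgroup Q G" and x: "x \<in> carrier G"
  shows "(\<forall>h\<in>Q. (R #> x) #> inv h = R #> x) \<longleftrightarrow> cj x Q \<subseteq> R"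
proof -
  interpret R: subgroup R G by fact
  interpret Q: subgroup Q G by fact
  have *: "(R #> x) #> inv h = R #> x \<longleftrightarrow> x \<otimes> inv h \<otimes> inv x \<in> R" if "h \<in> Q" for h
    using that x rcos_eq_iff[OF R, of "x \<otimes> inv h" x] R.subset by (simp add: coset_mult_assoc)
  show ?thesis
  proof
    assume l: "\<forall>h\<in>Q. (R #> x) #> inv h = R #> x"
    have "x \<otimes> h \<otimes> inv x \<in> R" if h: "h \<in> Q" for h
      using l[rule_format, of "inv h"] *[of "inv h"] h by simp
    then show "cj x Q \<subseteq> R" by (auto simp: cj_def)
  next
    assume r: "cj x Q \<subseteq> R"
    then have "x \<otimes> inv h \<otimes> inv x \<in> R" if "h \<in> Q" for h
      using that by (auto simp: cj_def)
    then show "\<forall>h\<in>Q. (R #> x) #> inv h = R #> x" using * by blast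
  qed
qed

text \<open>The \<open>r\<close>-group \<open>Q / C\<close> acts on the cosets of \<open>R\<close>
  in \<open>K\<close>, as \<open>C\<close> is normal and contained in \<open>R\<close> and so acts
  trivially. A Sylow subgroup \<open>Q\<close> yields conjugacy; the case \<open>Q = R\<close>
  yields the normalizer criterion.\<close>

lemma rcos_action_cong:
  assumes C: "C \<lhd> G" and R: "subgroup R G" "C \<subseteq> R" and K: "subgroup K G" "R \<subseteq> K"
    and Q: "subgroup Q G" "C \<subseteq> Q" "Q \<subseteq> K" and r: "Factorial_Ring.prime (r::nat)" "card Q = card C * r ^ k"
  shows "r * card R dvd card K \<longleftrightarrow> r dvd card ((\<lambda>x. R #> x) ` {x \<in> K. cj x Q \<subseteq> R})"
proof -
  interpret C: normal C G by fact
  interpret R: subgroup R G by fact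
  interpret K: subgroup K G by fact
  interpret Q: subgroup Q G by fact
  let ?E = "(\<lambda>x. R #> x) ` K"
  have "r * card R dvd card K \<longleftrightarrow> r dvd card ?E"
    unfolding card_rcosets_sub[OF R(1) K, symmetric] using card_sub_pos[OF R(1)] by simp
  also have "\<dots> \<longleftrightarrow> r dvd card {V \<in> ?E. \<forall>h\<in>Q. V #> inv h = V}"
  proof (rule fixed_points_cong[of Q C r k ?E "\<lambda>h V. V #> inv h"])
    show "finite ?E" using finite_sub[OF K(1)] by (rule finite_imageI)
    show "subgroup Q G" "subgroup C G" "C \<subseteq> Q" "Factorial_Ring.prime r" "card Q = card C * r ^ k"
      using Q r C.subgroup_axioms by blast+
    show "V #> inv h \<in> ?E" if hyp: "h \<in> Q" "V \<in> ?E" for h V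
    proof -
      obtain x where x: "x \<in> K" "V = R #> x" using hyp by blast
      have "h \<in> K" using hyp Q(3) by blast
      then have "V #> inv h = R #> (x \<otimes> inv h)" using x coset_mult_assoc[OF R.subset, of x "inv h"] by simp
      moreover have "x \<otimes> inv h \<in> K" using x \<open>h \<in> K\<close> by simp
      ultimately show ?thesis by blast
    qed
    show "V #> inv (g \<otimes> h) = (V #> inv h) #> inv g" if hyp: "g \<in> Q" "h \<in> Q" "V \<in> ?E" for g h V
    proof -
      obtain x where x: "x \<in> K" "V = R #> x" using hyp by blast
      have "V \<subseteq> carrier G" unfolding x(2) using r_coset_subset_G[OF R.subset K.mem_carrier[OF x(1)]] .
      then show ?thesis using hyp(1,2) coset_mult_assoc[of V "inv h" "inv g"] by (simp add: inv_mult_group)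
    qed
    show "V #> inv c = V" if hyp: "c \<in> C" "V \<in> ?E" for c V
    proof -
      obtain x where x: "x \<in> K" "V = R #> x" using hyp by blast
      have "cj x C \<subseteq> R" using cj_normal[OF C K.mem_carrier[OF x(1)]] R(2) by simp
      then show ?thesis unfolding x(2)
        using rcos_fixed_iff[OF R(1) C.subgroup_axioms K.mem_carrier[OF x(1)]] hyp(1) by blast
    qed
  qed
  also have "{V \<in> ?E. \<forall>h\<in>Q. V #> inv h = V} = (\<lambda>x. R #> x) ` {x \<in> K. cj x Q \<subseteq> R}"
    using rcos_fixed_iff[OF R(1) Q(1) subsetD[OF K.subset]] by blast
  finally show ?thesis .
qed

text \<open>For \<open>C \<lhd> G\<close> these are the preimages of the Sylow \<open>r\<close>-subgroups of \<open>K / C\<close>.\<close>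

definition syl :: "nat \<Rightarrow> 'a set \<Rightarrow> 'a set \<Rightarrow> 'a set set" where
  "syl r C K = {R. subgroup R G \<and> C \<subseteq> R \<and> R \<subseteq> K \<and> (\<exists>k. card R = card C * r ^ k) \<and> \<not> r * card R dvd card K}"

text \<open>A Sylow \<open>r\<close>-subgroup \<open>P\<close> of \<open>K\<close> is multiplied by
  \<open>C\<close>. The order of \<open>P <#> C\<close> contains the full \<open>r\<close>-part of
  \<open>card K\<close>, and its index over \<open>C\<close> is a power of \<open>r\<close>.\<close>

lemma syl_exists:
  assumes C: "C \<lhd> G" and K: "subgroup K G" "C \<subseteq> K" and r: "Factorial_Ring.prime (r::nat)"
  shows "syl r C K \<noteq> {}"
proof -
  interpret C: normal C G by fact
  let ?a = "multiplicity r (card K)"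
  have nz: "card K \<noteq> 0" "\<not> is_unit r" using card_sub_pos[OF K(1)] r by auto
  obtain m where m: "card K = r ^ ?a * m" using multiplicity_dvd by blast
  obtain P where P: "subgroup P (G\<lparr>carrier := K\<rparr>)" "card P = r ^ ?a"
    using sylow_thm[OF r subgroup_imp_group[OF K(1)], of ?a m] m finite_sub[OF K(1)]
    by (auto simp: order_def)
  have PK: "subgroup P G" "P \<subseteq> K" using incl_subgroup[OF K(1) P(1)] P(1) subgroup.subset by force+
  let ?R = "P <#> C"
  have R: "subgroup ?R G" by (rule set_mult_normal_subgroup[OF PK(1) C])
  have sub: "P \<subseteq> ?R" "C \<subseteq> ?R" using subset_set_mult[OF PK(1) C.subgroup_axioms] .
  have RK: "?R \<subseteq> K" by (rule set_mult_subset_sub[OF K(1) PK(2) K(2)])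
  have "card (P \<inter> C) dvd r ^ ?a"
    using card_sub_dvd[OF subgroups_Inter_pair[OF PK(1) C.subgroup_axioms] PK(1)] P(2) by simp
  then obtain i where i: "i \<le> ?a" "card (P \<inter> C) = r ^ i" using divides_primepow_nat[OF r] by blast
  have "card ?R * r ^ i = card C * r ^ (?a - i) * r ^ i"
    using card_set_mult[OF PK(1) C.subgroup_axioms] i P(2)
    by (simp add: mult.assoc mult.commute flip: power_add)
  then have cR: "card ?R = card C * r ^ (?a - i)" using r by (simp add: prime_gt_0_nat)
  have "\<not> r * card ?R dvd card K"
  proof
    assume "r * card ?R dvd card K"
    moreover have "r * r ^ ?a dvd r * card ?R" using card_sub_dvd[OF PK(1) R sub(1)] P(2) by simp
    ultimately have "r ^ Suc ?a dvd card K" using dvd_trans by fastforce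
    then have "Suc ?a \<le> ?a" by (rule multiplicity_geI[OF nz])
    then show False by simp
  qed
  then have "?R \<in> syl r C K" using R sub RK cR by (auto simp: syl_def)
  then show ?thesis by blast
qed

text \<open>The index of \<open>R\<close> in \<open>K\<close> is prime to \<open>r\<close>, so
  \<open>Q\<close> fixes some coset \<open>R #> x\<close>. This puts \<open>cj x Q\<close> inside
  \<open>R\<close>, and comparing orders gives equality.\<close>

lemma syl_conjugate:
  assumes C: "C \<lhd> G" and K: "subgroup K G" and r: "Factorial_Ring.prime (r::nat)"
    and R: "R \<in> syl r C K" and Q: "Q \<in> syl r C K"
  obtains g where "g \<in> K" "Q = cj g R"
proof -
  have R': "subgroup R G" "C \<subseteq> R" "R \<subseteq> K" "\<not> r * card R dvd card K" using R by (auto simp: syl_def)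
  have Q': "subgroup Q G" "C \<subseteq> Q" "Q \<subseteq> K" "\<not> r * card Q dvd card K" using Q by (auto simp: syl_def)
  obtain i j where ij: "card R = card C * r ^ i" "card Q = card C * r ^ j" using R Q by (auto simp: syl_def)
  have "\<not> r dvd card ((\<lambda>x. R #> x) ` {x \<in> K. cj x Q \<subseteq> R})"
    using rcos_action_cong[OF C R'(1,2) K R'(3) Q'(1,2,3) r ij(2)] R'(4) by simp
  then have "(\<lambda>x. R #> x) ` {x \<in> K. cj x Q \<subseteq> R} \<noteq> {}" by (intro notI) simp
  then obtain x where x: "x \<in> K" "cj x Q \<subseteq> R" by blast
  have xc: "x \<in> carrier G" using x K subgroup.subset by blast
  have c: "card (cj x Q) = card Q" using card_cj[OF xc] Q'(1) by (simp add: subgroup.subset)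
  \<comment> \<open>Otherwise \<open>r * card Q\<close> would divide \<open>card R\<close>, hence
    \<open>card K\<close>, against the Sylow property of \<open>Q\<close>.\<close>
  have "\<not> j < i"
  proof
    assume "j < i"
    then have "r * card Q dvd card R" unfolding ij by (simp add: le_imp_power_dvd flip: power_Suc)
    then show False using Q'(4) card_sub_dvd[OF R'(1) K R'(3)] dvd_trans by blast
  qed
  moreover have "card Q dvd card R" using card_sub_dvd[OF cj_subgroup[OF xc Q'(1)] R'(1) x(2)] c by simp
  then have "card Q \<le> card R" using card_sub_pos[OF R'(1)] dvd_imp_le by blast
  moreover have "card R \<le> card Q" if "i \<le> j"
    unfolding ij using that r by (simp add: power_increasing prime_gt_0_nat Suc_leI)
  ultimately have "card (cj x Q) = card R" using c by linarith
  then have "cj x Q = R" using card_subset_eq[OF finite_sub[OF R'(1)] x(2)] by simp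
  then have "Q = cj (inv x) R" using cj_inv_eq(1)[OF xc subgroup.subset[OF Q'(1)]] by simp
  moreover have "inv x \<in> K" using subgroup.m_inv_closed[OF K x(1)] .
  ultimately show thesis using that by blast
qed

lemma syl_cj:
  assumes C: "C \<lhd> G" and R: "R \<in> syl r C K" and g: "g \<in> carrier G" "cj g R \<subseteq> K"
  shows "cj g R \<in> syl r C K"
proof -
  have R': "subgroup R G" "C \<subseteq> R" using R by (auto simp: syl_def)
  have "C \<subseteq> cj g R" using cj_mono[OF R'(2)] cj_normal[OF C g(1)] by blast
  then show ?thesis
    using R g(2) cj_subgroup[OF g(1) R'(1)] card_cj[OF g(1) subgroup.subset[OF R'(1)]]
    by (simp add: syl_def)
qed

text \<open>Under the action of \<open>R\<close> on its own cosets in \<open>K\<close> the fixed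
  cosets are those inside the normalizer. Thus the Sylow property can be tested in
  \<open>K \<inter> nrm R\<close>.\<close>

lemma syl_normalizer_iff:
  assumes C: "C \<lhd> G" and K: "subgroup K G" and r: "Factorial_Ring.prime (r::nat)"
    and R: "subgroup R G" "C \<subseteq> R" "R \<subseteq> K" "card R = card C * r ^ k"
  shows "r * card R dvd card (K \<inter> nrm R) \<longleftrightarrow> r * card R dvd card K"
proof -
  have N: "subgroup (K \<inter> nrm R) G"
    using subgroups_Inter_pair[OF K nrm_subgroup[OF subgroup.subset[OF R(1)]]] .
  have RN: "R \<subseteq> K \<inter> nrm R" using R(3) cj_self[OF R(1)] subgroup.subset[OF R(1)] by (auto simp: nrm_def)
  have "{x \<in> K. cj x R \<subseteq> R} = K \<inter> nrm R"
    using cj_subset_eq[OF _ R(1)] subgroup.subset[OF K] by (auto simp: nrm_def)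
  then have "r * card R dvd card K \<longleftrightarrow> r dvd card ((\<lambda>x. R #> x) ` (K \<inter> nrm R))"
    using rcos_action_cong[OF C R(1,2) K R(3) R(1,2,3) r R(4)] by simp
  also have "\<dots> \<longleftrightarrow> r * card R dvd card (K \<inter> nrm R)"
    unfolding card_rcosets_sub[OF R(1) N RN, symmetric] using card_sub_pos[OF R(1)] by simp
  finally show ?thesis by blast
qed

lemma set_mult_normal:
  assumes "M \<lhd> G" "N \<lhd> G"
  shows "M <#> N \<lhd> G"
proof (rule normal_invI)
  interpret M: normal M G by fact
  interpret N: normal N G by fact
  show "subgroup (M <#> N) G" by (rule set_mult_normal_subgroup[OF M.subgroup_axioms assms(2)])
  fix x h assume x: "x \<in> carrier G" and "h \<in> M <#> N"
  then obtain m n where mn: "m \<in> M" "n \<in> N" "h = m \<otimes> n" unfolding set_mult_def by blast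
  then have "x \<otimes> h \<otimes> inv x = (x \<otimes> m \<otimes> inv x) \<otimes> (x \<otimes> n \<otimes> inv x)"
    using x by (simp add: m_assoc inv_cancel)
  then show "x \<otimes> h \<otimes> inv x \<in> M <#> N"
    unfolding set_mult_def using M.inv_op_closed2[OF x mn(1)] N.inv_op_closed2[OF x mn(2)] by blast
qed

text \<open>The elements of \<open>T\<close> carrying \<open>R\<close> to a given conjugate
  \<open>Q\<close> form a coset of \<open>T \<inter> nrm Q\<close>.\<close>

lemma card_eq_sum_normalizers:
  assumes T: "subgroup T G" and R: "subgroup R G"
  shows "card T = (\<Sum>Q\<in>(\<lambda>t. cj t R) ` T. card (T \<inter> nrm Q))"
proof -
  interpret T: subgroup T G by fact
  have Rc: "R \<subseteq> carrier G" using R by (rule subgroup.subset)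
  have "(\<Sum>Q\<in>(\<lambda>t. cj t R) ` T. \<Sum>t\<in>{t\<in>T. cj t R = Q}. (1::nat)) = (\<Sum>t\<in>T. 1)"
    by (rule sum.group) (simp_all add: finite_sub[OF T])
  then have "card T = (\<Sum>Q\<in>(\<lambda>t. cj t R) ` T. card {t\<in>T. cj t R = Q})" by simp
  also have "\<dots> = (\<Sum>Q\<in>(\<lambda>t. cj t R) ` T. card (T \<inter> nrm Q))"
  proof (rule sum.cong[OF refl])
    fix Q assume "Q \<in> (\<lambda>t. cj t R) ` T"
    then obtain u where u: "u \<in> T" "Q = cj u R" by blast
    have Qc: "Q \<subseteq> carrier G" using u cj_carrier Rc by simp
    have "(\<lambda>s. s \<otimes> u) ` (T \<inter> nrm Q) = {t\<in>T. cj t R = Q}"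
    proof (intro equalityI subsetI)
      fix t assume "t \<in> (\<lambda>s. s \<otimes> u) ` (T \<inter> nrm Q)"
      then obtain s where s: "s \<in> T" "s \<in> nrm Q" "t = s \<otimes> u" by blast
      then have "cj t R = cj s Q" using cj_mult[OF _ _ Rc, of s u] u by simp
      then show "t \<in> {t\<in>T. cj t R = Q}" using s u by (simp add: nrm_def)
    next
      fix t assume "t \<in> {t\<in>T. cj t R = Q}"
      then have t: "t \<in> T" "cj t R = Q" by auto
      have "cj (t \<otimes> inv u) Q = cj t (cj (inv u) Q)" using cj_mult[OF _ _ Qc] t u by simp
      also have "\<dots> = Q" using cj_inv_eq(1)[OF _ Rc] u t by simp
      finally have "t \<otimes> inv u \<in> T \<inter> nrm Q" using t u by (simp add: nrm_def)
      moreover have "t = (t \<otimes> inv u) \<otimes> u" using t u by (simp add: m_assoc)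
      ultimately show "t \<in> (\<lambda>s. s \<otimes> u) ` (T \<inter> nrm Q)" by blast
    qed
    moreover have "inj_on (\<lambda>s. s \<otimes> u) (T \<inter> nrm Q)" using u by (auto intro!: inj_onI)
    then have "card ((\<lambda>s. s \<otimes> u) ` (T \<inter> nrm Q)) = card (T \<inter> nrm Q)" by (rule card_image)
    ultimately show "card {t\<in>T. cj t R = Q} = card (T \<inter> nrm Q)" by simp
  qed
  finally show ?thesis .
qed

end

subsection \<open>Sections with a nontrivial normal r-subgroup\<close>

text \<open>\<open>H\<close> is the preimage of a nontrivial normal \<open>r\<close>-subgroup of \<open>G / C L\<close>.\<close>

locale r_section = fin_group +
  fixes C L H :: "'a set" and r k :: nat
  assumes C: "C \<lhd> G" and L: "L \<lhd> G" and H: "H \<lhd> G" and r: "Factorial_Ring.prime r"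
    and CLH: "C <#> L \<subset> H" and card_H: "card H = card (C <#> L) * r ^ k"
begin

interpretation C: normal C G by (rule C)
interpretation L: normal L G by (rule L)
interpretation H: normal H G by (rule H)

lemma CL_normal: "C <#> L \<lhd> G"
  by (rule set_mult_normal[OF C L])

lemma Dedekind_L:
  assumes "subgroup R G" "subgroup Z G" "R \<subseteq> Z"
  shows "(R <#> L) \<inter> Z = (Z \<inter> L) <#> R"
  using dedekind[OF assms(2) L.subset assms(3)] commut_normal[OF assms(1) L] by (simp add: Int_commute)

text \<open>The index of the left side in \<open>Z \<inter> H\<close> is a power of
  \<open>r\<close>, because \<open>H / C L\<close> is an \<open>r\<close>-group, and it is prime to
  \<open>r\<close>, because \<open>R\<close> is contained in it. So it is 1.\<close>

lemma syl_mult_eq: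
  assumes Z: "subgroup Z G" "C \<subseteq> Z" and R: "R \<in> syl r C (Z \<inter> H)"
  shows "(Z \<inter> L) <#> R = Z \<inter> H"
proof -
  let ?D = "C <#> L" and ?K = "Z \<inter> H" and ?Y = "(Z \<inter> L) <#> R"
  have R': "subgroup R G" "C \<subseteq> R" "R \<subseteq> ?K" "\<not> r * card R dvd card ?K" using R by (auto simp: syl_def)
  have K: "subgroup ?K G" by (rule subgroups_Inter_pair[OF Z(1) H.subgroup_axioms])
  have T: "subgroup (Z \<inter> L) G" by (rule subgroups_Inter_pair[OF Z(1) L.subgroup_axioms])
  have D: "subgroup ?D G" by (rule normal_imp_subgroup[OF CL_normal])
  have LD: "L \<subseteq> ?D" "C \<subseteq> ?D" using subset_set_mult[OF C.subgroup_axioms L.subgroup_axioms] by auto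
  have Yeq: "?Y = (R <#> L) \<inter> Z" using Dedekind_L[OF R'(1) Z(1)] R'(3) by simp
  have Y: "subgroup ?Y G"
    unfolding Yeq by (rule subgroups_Inter_pair[OF set_mult_normal_subgroup[OF R'(1) L] Z(1)])
  have YK: "?Y \<subseteq> ?K" using R'(3) LD CLH by (intro set_mult_subset_sub[OF K]) blast+
  have RY: "R \<subseteq> ?Y" using subset_set_mult(2)[OF T R'(1)] .
  have "?K \<inter> ?D = ?D \<inter> Z" using CLH by auto
  also have "\<dots> = (Z \<inter> L) <#> C" by (rule Dedekind_L[OF C.subgroup_axioms Z])
  finally have KD: "?K \<inter> ?D \<subseteq> ?Y" using mono_set_mult[OF subset_refl R'(2), where H = "Z \<inter> L" and G = G] by simp
  have KD': "subgroup (?K \<inter> ?D) G" by (rule subgroups_Inter_pair[OF K D])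
  \<comment> \<open>The quotient of \<open>?K <#> ?D\<close> by \<open>?D\<close> lies in the
    \<open>r\<close>-group \<open>H / ?D\<close>, so \<open>?K \<inter> ?D\<close> has
    \<open>r\<close>-power index in \<open>?K\<close>.\<close>
  have S: "subgroup (?K <#> ?D) G" by (rule set_mult_normal_subgroup[OF K CL_normal])
  have "?K <#> ?D \<subseteq> H" using psubset_imp_subset[OF CLH] by (rule set_mult_subset_sub[OF H.subgroup_axioms Int_lower2])
  then have "card (?K <#> ?D) dvd card ?D * r ^ k" using card_sub_dvd[OF S H.subgroup_axioms] card_H by simp
  moreover obtain u where u: "card (?K <#> ?D) = card ?D * u"
    using card_sub_dvd[OF D S subset_set_mult(2)[OF K D]] by blast
  ultimately have "u dvd r ^ k" using card_sub_pos[OF D] by simp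
  then obtain i where i: "u = r ^ i" using divides_primepow_nat[OF r] by blast
  have cK: "card ?K = r ^ i * card (?K \<inter> ?D)"
    using card_set_mult[OF K D] card_sub_pos[OF D] unfolding u i by (simp add: mult.commute mult.left_commute)
  obtain v where v: "card ?Y = card (?K \<inter> ?D) * v" using card_sub_dvd[OF KD' Y KD] by blast
  obtain w where w: "card ?K = card ?Y * w" using card_sub_dvd[OF Y K YK] by blast
  have "r ^ i = v * w" using cK w card_sub_pos[OF KD'] unfolding v by simp
  then have "w dvd r ^ i" by simp
  then obtain j where j: "w = r ^ j" using divides_primepow_nat[OF r] by blast
  have "j = 0"
  proof (rule ccontr)
    assume "j \<noteq> 0"
    then have "r dvd w" using j by (simp add: dvd_power)
    then have "card R * r dvd card ?Y * w" using card_sub_dvd[OF R'(1) Y RY] by (rule mult_dvd_mono[rotated])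
    then show False using R'(4) w by (simp add: mult.commute)
  qed
  then have "card ?Y = card ?K" using w j by simp
  then show ?thesis using card_subset_eq[OF finite_sub[OF K] YK] by simp
qed

text \<open>An element of \<open>Z \<inter> H\<close> conjugating \<open>R\<close> to
  \<open>Q\<close> factors as \<open>t \<otimes> s\<close> with \<open>t\<close> in
  \<open>Z \<inter> L\<close> and \<open>s\<close> in \<open>R\<close>, and \<open>s\<close>
  normalizes \<open>R\<close>.\<close>

lemma syl_orbit:
  assumes Z: "subgroup Z G" "C \<subseteq> Z" and R: "R \<in> syl r C (Z \<inter> H)"
  shows "syl r C (Z \<inter> H) = (\<lambda>t. cj t R) ` (Z \<inter> L)"
proof (intro equalityI subsetI)
  let ?K = "Z \<inter> H"
  have K: "subgroup ?K G" by (rule subgroups_Inter_pair[OF Z(1) H.subgroup_axioms])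
  have R': "subgroup R G" "R \<subseteq> ?K" using R by (auto simp: syl_def)
  have Rc: "R \<subseteq> carrier G" by (rule subgroup.subset[OF R'(1)])
  {
    fix Q assume "Q \<in> syl r C ?K"
    then obtain g where g: "g \<in> ?K" "Q = cj g R" using syl_conjugate[OF C K r R] by blast
    then obtain t s where ts: "t \<in> Z \<inter> L" "s \<in> R" "g = t \<otimes> s"
      using syl_mult_eq[OF Z R] unfolding set_mult_def by blast
    have "Q = cj t (cj s R)" unfolding g ts(3) using ts L.subset Rc by (intro cj_mult) auto
    then have "Q = cj t R" using cj_self[OF R'(1) ts(2)] by simp
    then show "Q \<in> (\<lambda>t. cj t R) ` (Z \<inter> L)" using ts by blast
  next
    fix Q assume "Q \<in> (\<lambda>t. cj t R) ` (Z \<inter> L)"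
    then obtain t where t: "t \<in> Z \<inter> L" "Q = cj t R" by blast
    have "L \<subseteq> H" using subset_set_mult(2)[OF C.subgroup_axioms L.subgroup_axioms] CLH by blast
    then have tK: "t \<in> ?K" using t by blast
    then have "cj t R \<subseteq> ?K" using cj_mono[OF R'(2), of t] cj_self[OF K tK] by simp
    then show "Q \<in> syl r C ?K" unfolding t(2) using t L.subset by (intro syl_cj[OF C R]) auto
  }
qed

text \<open>The Frattini argument: for \<open>z\<close> in \<open>Z\<close> the conjugate
  \<open>cj z R\<close> is again Sylow in \<open>Z \<inter> H\<close>, so it equals
  \<open>cj t R\<close> with \<open>t\<close> in \<open>Z \<inter> L\<close>, and
  \<open>inv t \<otimes> z\<close> normalizes \<open>R\<close>.\<close>

lemma frattini:
  assumes Z: "subgroup Z G" "C \<subseteq> Z" "Z <#> L = carrier G" and R: "R \<in> syl r C (Z \<inter> H)"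
  shows "(Z \<inter> nrm R) <#> L = carrier G"
proof -
  interpret Z: subgroup Z G by (rule Z(1))
  have R': "subgroup R G" "R \<subseteq> Z \<inter> H" using R by (auto simp: syl_def)
  have Rc: "R \<subseteq> carrier G" by (rule subgroup.subset[OF R'(1)])
  have N: "subgroup (Z \<inter> nrm R) G" by (rule subgroups_Inter_pair[OF Z(1) nrm_subgroup[OF Rc]])
  have S: "subgroup ((Z \<inter> nrm R) <#> L) G" by (rule set_mult_normal_subgroup[OF N L])
  have "z \<in> (Z \<inter> nrm R) <#> L" if z: "z \<in> Z" for z
  proof -
    have "cj z R \<subseteq> cj z Z \<inter> cj z H" using R'(2) by (auto simp: cj_def)
    then have "cj z R \<subseteq> Z \<inter> H" using cj_self[OF Z(1) z] cj_normal[OF H Z.mem_carrier[OF z]] by simp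
    then have "cj z R \<in> syl r C (Z \<inter> H)" using syl_cj[OF C R Z.mem_carrier[OF z]] by blast
    then obtain t where t: "t \<in> Z" "t \<in> L" "cj z R = cj t R" using syl_orbit[OF Z(1,2) R] by blast
    define s where "s = inv t \<otimes> z"
    have sZ: "s \<in> Z" "s \<in> carrier G" using t z by (auto simp: s_def)
    have "cj s R = cj (inv t) (cj t R)" using t z Rc by (simp add: s_def cj_mult flip: t(3))
    then have "s \<in> Z \<inter> nrm R" using sZ t cj_inv_eq(1)[OF _ Rc, of t] by (simp add: nrm_def)
    \<comment> \<open>Conjugating \<open>t\<close> by \<open>s\<close> moves the factor from
      \<open>L\<close> to the right of the factor from the normalizer.\<close>
    moreover have "inv s \<otimes> t \<otimes> s \<in> L" using t sZ by (intro L.inv_op_closed1)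
    moreover have "z = s \<otimes> (inv s \<otimes> t \<otimes> s)" using t z sZ by (simp add: s_def m_assoc inv_cancel)
    ultimately show ?thesis unfolding set_mult_def by blast
  qed
  then have "Z <#> L \<subseteq> (Z \<inter> nrm R) <#> L"
    using subset_set_mult(2)[OF N L.subgroup_axioms] by (intro set_mult_subset_sub[OF S]) auto
  then show ?thesis using subgroup.subset[OF S] Z(3) by auto
qed

text \<open>With \<open>W = Z \<inter> nrm R\<close> this expresses, in terms of \<open>W\<close>
  alone, that \<open>Z\<close> is a supplement of \<open>L\<close> containing \<open>C\<close> and
  that \<open>R\<close> is Sylow in \<open>Z \<inter> H\<close>.\<close>

definition syl_local :: "'a set \<Rightarrow> 'a set \<Rightarrow> bool" where
  "syl_local R W \<longleftrightarrow> R \<subseteq> W \<and> R \<subseteq> H \<and> W <#> L = carrier G \<and> \<not> r * card R dvd card (W \<inter> H)"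

text \<open>The Sylow condition is insensitive to passing to the normalizer. The supplement
  condition passes up from \<open>Z \<inter> nrm R\<close> by monotonicity and down by the Frattini
  argument.\<close>

lemma syl_local_iff:
  assumes Z: "subgroup Z G" and R: "subgroup R G" "C \<subseteq> R" "card R = card C * r ^ j"
  shows "syl_local R (Z \<inter> nrm R) \<longleftrightarrow> C \<subseteq> Z \<and> Z <#> L = carrier G \<and> R \<in> syl r C (Z \<inter> H)"
proof -
  have K: "subgroup (Z \<inter> H) G" by (rule subgroups_Inter_pair[OF Z H.subgroup_axioms])
  have RN: "R \<subseteq> nrm R" using cj_self[OF R(1)] subgroup.subset[OF R(1)] by (auto simp: nrm_def)
  have I: "Z \<inter> nrm R \<inter> H = Z \<inter> H \<inter> nrm R" by auto
  have iff: "r * card R dvd card (Z \<inter> nrm R \<inter> H) \<longleftrightarrow> r * card R dvd card (Z \<inter> H)" if "R \<subseteq> Z" "R \<subseteq> H"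
    unfolding I using that by (intro syl_normalizer_iff[OF C K r R(1,2) _ R(3)]) blast
  show ?thesis
  proof
    assume l: "syl_local R (Z \<inter> nrm R)"
    have "(Z \<inter> nrm R) <#> L \<subseteq> Z <#> L" by (rule mono_set_mult) auto
    moreover have "Z <#> L \<subseteq> carrier G" by (rule set_mult_closed[OF subgroup.subset[OF Z] L.subset])
    ultimately have "Z <#> L = carrier G" using l by (auto simp: syl_local_def)
    then show "C \<subseteq> Z \<and> Z <#> L = carrier G \<and> R \<in> syl r C (Z \<inter> H)"
      using l R iff unfolding syl_def syl_local_def by blast
  next
    assume a: "C \<subseteq> Z \<and> Z <#> L = carrier G \<and> R \<in> syl r C (Z \<inter> H)"
    then show "syl_local R (Z \<inter> nrm R)"
      using frattini[OF Z, of R] RN iff unfolding syl_def syl_local_def by blast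
  qed
qed

text \<open>The hypothesis \<open>nn\<close> handles the normal \<open>R\<close>, to which Weisner's
  theorem does not apply: these lie in \<open>C <#> L\<close> and are never Sylow in
  \<open>Z \<inter> H\<close> for a supplement \<open>Z\<close>.\<close>

theorem m_sum_eq_0:
  assumes nn: "\<And>R j. R \<lhd> G \<Longrightarrow> C \<subseteq> R \<Longrightarrow> card R = card C * r ^ j \<Longrightarrow> R \<subseteq> C <#> L"
  shows "m_sum C L = 0"
proof -
  define S where "S = {Z. subgroup Z G \<and> C \<subseteq> Z \<and> Z <#> L = carrier G}"
  define RR where "RR = {R. subgroup R G \<and> C \<subseteq> R \<and> (\<exists>j. card R = card C * r ^ j)}"
  have finRR: "finite RR" unfolding RR_def by (rule finite_subgroups)
  have fins: "finite {Z. subgroup Z G}" using finite_subgroups[of "\<lambda>_. True"] by simp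
  let ?f = "\<lambda>R W. if syl_local R W then int (card (W \<inter> L)) else 0"
  \<comment> \<open>The sum over the Sylow subgroups of \<open>Z \<inter> H\<close> is enlarged to
    \<open>RR\<close>, which does not depend on \<open>Z\<close>; the extra terms are zero by
    \<open>syl_local_iff\<close>.\<close>
  have 1: "int (card (Z \<inter> L)) = (\<Sum>R\<in>RR. ?f R (Z \<inter> nrm R))" if Z: "Z \<in> S" for Z
  proof -
    have Z': "subgroup Z G" "C \<subseteq> Z" "Z <#> L = carrier G" using Z by (auto simp: S_def)
    have K: "subgroup (Z \<inter> H) G" by (rule subgroups_Inter_pair[OF Z'(1) H.subgroup_axioms])
    have T: "subgroup (Z \<inter> L) G" by (rule subgroups_Inter_pair[OF Z'(1) L.subgroup_axioms])
    have "C \<subseteq> H" using subset_set_mult(1)[OF C.subgroup_axioms L.subgroup_axioms] CLH by blast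
    then obtain R0 where R0: "R0 \<in> syl r C (Z \<inter> H)" using syl_exists[OF C K _ r] Z'(2) by blast
    then have "subgroup R0 G" by (auto simp: syl_def)
    then have "card (Z \<inter> L) = (\<Sum>R\<in>syl r C (Z \<inter> H). card (Z \<inter> L \<inter> nrm R))"
      unfolding syl_orbit[OF Z'(1,2) R0] by (rule card_eq_sum_normalizers[OF T])
    then have "int (card (Z \<inter> L)) = (\<Sum>R\<in>syl r C (Z \<inter> H). int (card (Z \<inter> nrm R \<inter> L)))"
      by (simp add: Int_ac)
    also have "\<dots> = (\<Sum>R\<in>RR. ?f R (Z \<inter> nrm R))"
    proof (rule sum.mono_neutral_cong_left[OF finRR])
      have loc: "syl_local R (Z \<inter> nrm R) \<longleftrightarrow> R \<in> syl r C (Z \<inter> H)" if "R \<in> RR" for R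
        using that syl_local_iff[OF Z'(1), of R] Z' by (auto simp: RR_def)
      show sub: "syl r C (Z \<inter> H) \<subseteq> RR" by (auto simp: RR_def syl_def)
      show "\<forall>R\<in>RR - syl r C (Z \<inter> H). ?f R (Z \<inter> nrm R) = 0" using loc by simp
      show "int (card (Z \<inter> nrm R \<inter> L)) = ?f R (Z \<inter> nrm R)" if "R \<in> syl r C (Z \<inter> H)" for R
        using that loc sub by auto
    qed
    finally show ?thesis .
  qed
  \<comment> \<open>Subgroups outside \<open>S\<close> contribute nothing, so the sum may run over
    all subgroups, as Weisner's theorem demands.\<close>
  have 0: "?f R (Z \<inter> nrm R) = 0" if Z: "subgroup Z G" "Z \<notin> S" and R: "R \<in> RR" for R Z
    using that syl_local_iff[OF Z(1), of R] by (auto simp: RR_def S_def)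
  have "int (card L) * m_sum C L = (\<Sum>Z\<in>S. (int (card L) * int (card Z)) * \<mu> Z)"
    by (simp add: m_sum_def S_def sum_distrib_left mult.assoc)
  also have "\<dots> = (\<Sum>Z\<in>S. int (card (carrier G)) * (int (card (Z \<inter> L)) * \<mu> Z))"
  proof (rule sum.cong[OF refl])
    fix Z assume "Z \<in> S"
    then have "card (carrier G) * card (Z \<inter> L) = card Z * card L"
      using card_set_mult[of Z L] L.subgroup_axioms by (auto simp: S_def)
    then have "int (card L) * int (card Z) = int (card (carrier G)) * int (card (Z \<inter> L))"
      by (simp only: of_nat_mult[symmetric] mult.commute)
    then show "(int (card L) * int (card Z)) * \<mu> Z = int (card (carrier G)) * (int (card (Z \<inter> L)) * \<mu> Z)"
      by (simp only: mult.assoc)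
  qed
  also have "\<dots> = int (card (carrier G)) * (\<Sum>Z\<in>S. int (card (Z \<inter> L)) * \<mu> Z)"
    by (simp only: sum_distrib_left)
  also have "(\<Sum>Z\<in>S. int (card (Z \<inter> L)) * \<mu> Z)
      = (\<Sum>Z\<in>{Z. subgroup Z G}. \<Sum>R\<in>RR. ?f R (Z \<inter> nrm R) * \<mu> Z)"
  proof (rule sum.mono_neutral_cong_left[OF fins])
    show "\<forall>Z\<in>{Z. subgroup Z G} - S. (\<Sum>R\<in>RR. ?f R (Z \<inter> nrm R) * \<mu> Z) = 0"
    proof
      fix Z assume Z: "Z \<in> {Z. subgroup Z G} - S"
      show "(\<Sum>R\<in>RR. ?f R (Z \<inter> nrm R) * \<mu> Z) = 0"
      proof (rule sum.neutral, rule)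
        fix R assume "R \<in> RR"
        then have "?f R (Z \<inter> nrm R) = 0" using 0 Z by blast
        then show "?f R (Z \<inter> nrm R) * \<mu> Z = 0" by (simp only: mult_zero_left)
      qed
    qed
    show "int (card (Z \<inter> L)) * \<mu> Z = (\<Sum>R\<in>RR. ?f R (Z \<inter> nrm R) * \<mu> Z)" if "Z \<in> S" for Z
      unfolding 1[OF that] by (rule sum_distrib_right)
  qed (auto simp: S_def)
  also have "\<dots> = (\<Sum>R\<in>RR. \<Sum>Z\<in>{Z. subgroup Z G}. ?f R (Z \<inter> nrm R) * \<mu> Z)"
    by (rule sum.swap)
  also have "\<dots> = 0"
  proof (rule sum.neutral, rule)
    fix R assume R: "R \<in> RR"
    then obtain j where R': "subgroup R G" "C \<subseteq> R" "card R = card C * r ^ j" by (auto simp: RR_def)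
    show "(\<Sum>Z\<in>{Z. subgroup Z G}. ?f R (Z \<inter> nrm R) * \<mu> Z) = 0"
    proof (cases "nrm R = carrier G")
      case False
      then show ?thesis by (rule sum_local_eq_0[OF nrm_subgroup[OF subgroup.subset[OF R'(1)]]])
    next
      case True
      \<comment> \<open>If such an \<open>R\<close> were Sylow in \<open>Z \<inter> H\<close>, then
        \<open>Z \<inter> H\<close>, and with it \<open>H = (Z \<inter> H) <#> L\<close>, would lie
        in \<open>C <#> L\<close>.\<close>
      have RD: "R \<subseteq> C <#> L" using nn nrm_carrier_imp_normal[OF R'(1) True] R' by blast
      have "\<not> syl_local R (Z \<inter> nrm R)" if Z: "subgroup Z G" for Z
      proof
        assume "syl_local R (Z \<inter> nrm R)"
        then have Z': "C \<subseteq> Z" "Z <#> L = carrier G" "R \<in> syl r C (Z \<inter> H)"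
          using syl_local_iff[OF Z R'] by auto
        have LD: "L \<subseteq> C <#> L" using subset_set_mult(2)[OF C.subgroup_axioms L.subgroup_axioms] .
        have Dsub: "subgroup (C <#> L) G" using CL_normal by (rule normal_imp_subgroup)
        have "Z \<inter> H \<subseteq> C <#> L"
          unfolding syl_mult_eq[OF Z Z'(1,3), symmetric] using LD RD by (intro set_mult_subset_sub[OF Dsub]) auto
        moreover have "H = (Z \<inter> H) <#> L"
          using dedekind[OF H.subgroup_axioms subgroup.subset[OF Z], of L] Z'(2) LD CLH H.subset by auto
        ultimately have "H \<subseteq> C <#> L" using set_mult_subset_sub[OF Dsub _ LD] by metis
        then show False using CLH by blast
      qed
      then show ?thesis by simp
    qed
  qed
  finally show ?thesis using card_sub_pos[OF L.subgroup_axioms] by simp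
qed

end

subsection \<open>Perfect chief factors\<close>

context fin_group
begin

section \<open>Centralizers of sections and derived series\<close>

lemma set_multE:
  assumes "x \<in> H <#> K"
  obtains h k where "h \<in> H" "k \<in> K" "x = h \<otimes> k"
  using assms unfolding set_mult_def by blast

text \<open>For normal \<open>M\<close> this is the preimage in \<open>G\<close> of the centralizer
  of the image of \<open>Y\<close> in \<open>G / M\<close>.\<close>

definition cent :: "'a set \<Rightarrow> 'a set \<Rightarrow> 'a set" where
  "cent Y M = {g \<in> carrier G. \<forall>y\<in>Y. g \<otimes> y \<otimes> inv g \<otimes> inv y \<in> M}"

lemma cent_subgroup:
  assumes M: "M \<lhd> G" and Y: "Y \<subseteq> carrier G"
  shows "subgroup (cent Y M) G"
proof (rule subgroupI)
  interpret M: normal M G by fact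
  show "cent Y M \<noteq> {}"
  proof -
    have "\<one> \<in> cent Y M" using Y by (auto simp: cent_def subset_iff)
    then show ?thesis by blast
  qed
  fix g assume g: "g \<in> cent Y M"
  then have gc: "g \<in> carrier G" by (simp add: cent_def)
  show "inv g \<in> cent Y M"
  proof -
    have "inv g \<otimes> y \<otimes> inv (inv g) \<otimes> inv y \<in> M" if y: "y \<in> Y" for y
    proof -
      have yc: "y \<in> carrier G" using y Y by blast
      have "inv (g \<otimes> y \<otimes> inv g \<otimes> inv y) \<in> M" using g y by (simp add: cent_def)
      then have "inv g \<otimes> inv (g \<otimes> y \<otimes> inv g \<otimes> inv y) \<otimes> g \<in> M" by (rule M.inv_op_closed1[OF gc])
      then show ?thesis using gc yc by (simp add: m_assoc inv_mult_group inv_cancel)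
    qed
    then show ?thesis using gc by (simp add: cent_def)
  qed
  fix h assume h: "h \<in> cent Y M"
  then have hc: "h \<in> carrier G" by (simp add: cent_def)
  show "g \<otimes> h \<in> cent Y M"
  proof -
    have "(g \<otimes> h) \<otimes> y \<otimes> inv (g \<otimes> h) \<otimes> inv y \<in> M" if y: "y \<in> Y" for y
    proof -
      have yc: "y \<in> carrier G" using y Y by blast
      have "h \<otimes> y \<otimes> inv h \<otimes> inv y \<in> M" using h y by (simp add: cent_def)
      then have "g \<otimes> (h \<otimes> y \<otimes> inv h \<otimes> inv y) \<otimes> inv g \<in> M" by (rule M.inv_op_closed2[OF gc])
      moreover have "g \<otimes> y \<otimes> inv g \<otimes> inv y \<in> M" using g y by (simp add: cent_def)
      ultimately have "g \<otimes> (h \<otimes> y \<otimes> inv h \<otimes> inv y) \<otimes> inv g \<otimes> (g \<otimes> y \<otimes> inv g \<otimes> inv y) \<in> M"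
        by (rule M.m_closed)
      then show ?thesis using gc hc yc by (simp add: m_assoc inv_mult_group inv_cancel)
    qed
    then show ?thesis using gc hc by (simp add: cent_def)
  qed
qed (auto simp: cent_def)

lemma cent_normal:
  assumes M: "M \<lhd> G" and Y: "Y \<lhd> G"
  shows "cent Y M \<lhd> G"
proof (rule normal_invI)
  interpret M: normal M G by fact
  interpret Y: normal Y G by fact
  show "subgroup (cent Y M) G" by (rule cent_subgroup[OF M Y.subset])
  fix x g assume x: "x \<in> carrier G" and g: "g \<in> cent Y M"
  then have gc: "g \<in> carrier G" by (simp add: cent_def)
  have "(x \<otimes> g \<otimes> inv x) \<otimes> y \<otimes> inv (x \<otimes> g \<otimes> inv x) \<otimes> inv y \<in> M" if y: "y \<in> Y" for y
  proof -
    let ?y = "inv x \<otimes> y \<otimes> x"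
    have yc: "y \<in> carrier G" using y by simp
    have "?y \<in> Y" by (rule Y.inv_op_closed1[OF x y])
    then have "g \<otimes> ?y \<otimes> inv g \<otimes> inv ?y \<in> M" using g by (simp add: cent_def)
    then have "x \<otimes> (g \<otimes> ?y \<otimes> inv g \<otimes> inv ?y) \<otimes> inv x \<in> M" by (rule M.inv_op_closed2[OF x])
    then show ?thesis using x gc yc by (simp add: m_assoc inv_mult_group inv_cancel)
  qed
  then show "x \<otimes> g \<otimes> inv x \<in> cent Y M" using x gc by (simp add: cent_def)
qed

lemma normal_subset_cent:
  assumes M: "M \<lhd> G" and Y: "Y \<subseteq> carrier G"
  shows "M \<subseteq> cent Y M"
proof
  interpret M: normal M G by fact
  fix m assume m: "m \<in> M"
  have "m \<otimes> y \<otimes> inv m \<otimes> inv y \<in> M" if y: "y \<in> Y" for y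
  proof -
    have yc: "y \<in> carrier G" using y Y by blast
    have "y \<otimes> inv m \<otimes> inv y \<in> M" using m by (intro M.inv_op_closed2[OF yc]) simp
    then have "m \<otimes> (y \<otimes> inv m \<otimes> inv y) \<in> M" using m by simp
    then show ?thesis using m yc by (simp add: m_assoc)
  qed
  then show "m \<in> cent Y M" using m by (simp add: cent_def)
qed

lemma cent_sym:
  assumes M: "subgroup M G" and "x \<in> carrier G" "y \<in> carrier G" "x \<otimes> y \<otimes> inv x \<otimes> inv y \<in> M"
  shows "y \<otimes> x \<otimes> inv y \<otimes> inv x \<in> M"
proof -
  have "inv (x \<otimes> y \<otimes> inv x \<otimes> inv y) \<in> M" using assms(4) by (rule subgroup.m_inv_closed[OF M])
  then show ?thesis using assms(2,3) by (simp add: inv_mult_group m_assoc)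
qed

lemma derived_subset_iff_cent:
  assumes "subgroup K G" "Y \<subseteq> carrier G"
  shows "derived G Y \<subseteq> K \<longleftrightarrow> Y \<subseteq> cent Y K"
proof
  assume D: "derived G Y \<subseteq> K"
  show "Y \<subseteq> cent Y K"
  proof
    fix x assume x: "x \<in> Y"
    have "x \<otimes> y \<otimes> inv x \<otimes> inv y \<in> K" if y: "y \<in> Y" for y
    proof -
      have "x \<otimes> y \<otimes> inv x \<otimes> inv y \<in> derived_set G Y" using x y by auto
      then have "x \<otimes> y \<otimes> inv x \<otimes> inv y \<in> derived G Y" unfolding derived_def by (rule generate.incl)
      then show ?thesis using D by blast
    qed
    then show "x \<in> cent Y K" using x assms(2) by (auto simp: cent_def)
  qed
next
  assume "Y \<subseteq> cent Y K"
  then have "derived_set G Y \<subseteq> K" by (auto simp: cent_def)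
  then show "derived G Y \<subseteq> K" unfolding derived_def by (rule generate_subgroup_incl[OF _ assms(1)])
qed

lemma derived_exp_normal: "(derived G ^^ n) (carrier G) \<lhd> G"
  by (induction n) (simp_all add: normal_self derived_is_normal)

lemma perfect_derived_exp:
  assumes "derived G L = L"
  shows "(derived G ^^ n) L = L"
  by (induction n) (simp_all add: assms)

lemma hom_Mod: "N \<lhd> G \<Longrightarrow> group_hom G (G Mod N) (\<lambda>x. N #> x)"
  unfolding group_hom_def group_hom_axioms_def
  using normal.factorgroup_is_group normal.r_coset_hom_Mod is_group by blast

text \<open>\<open>U\<close> and \<open>G\<close> have the same image in \<open>G / C\<close>, hence
  so do the terms of their derived series.\<close>

lemma derived_exp_subset_of_set_mult:
  assumes C: "C \<lhd> G" and U: "subgroup U G" "U <#> C = carrier G" and sub: "(derived G ^^ n) U \<subseteq> C"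
  shows "(derived G ^^ n) (carrier G) \<subseteq> C"
proof
  interpret C: normal C G by fact
  interpret h: group_hom G "G Mod C" "\<lambda>x. C #> x" by (rule hom_Mod[OF C])
  have "C #> g \<in> (\<lambda>x. C #> x) ` U" if "g \<in> carrier G" for g
  proof -
    obtain x c where xc: "x \<in> U" "c \<in> C" "g = x \<otimes> c" using U(2) \<open>g \<in> carrier G\<close> unfolding set_mult_def by blast
    have x: "x \<in> carrier G" using xc U subgroup.subset by blast
    have "g \<otimes> inv x \<in> C" unfolding xc(3) by (rule C.inv_op_closed2[OF x xc(2)])
    then have "C #> g = C #> x" using rcos_eq_iff[OF C.subgroup_axioms \<open>g \<in> carrier G\<close> x] by simp
    then show ?thesis using xc by blast
  qed
  then have "(\<lambda>x. C #> x) ` carrier G = (\<lambda>x. C #> x) ` U" using subgroup.subset[OF U(1)] by auto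
  then have eq: "(\<lambda>x. C #> x) ` (derived G ^^ n) (carrier G) = (\<lambda>x. C #> x) ` (derived G ^^ n) U"
    using h.exp_of_derived_img[of "carrier G" n] h.exp_of_derived_img[OF subgroup.subset[OF U(1)], of n] by simp
  fix g assume g: "g \<in> (derived G ^^ n) (carrier G)"
  then obtain c where c: "c \<in> (derived G ^^ n) U" "C #> g = C #> c" using eq by blast
  have gc: "g \<in> carrier G" using g exp_of_derived_in_carrier[of "carrier G" n] by blast
  have "c \<in> C" using c sub by blast
  then have "C #> g = C" using c(2) C.rcos_const[OF is_group] by simp
  then show "g \<in> C" using coset_join1[OF _ gc C.subgroup_axioms] by blast
qed

text \<open>The last nontrivial term of the derived series of \<open>G / D\<close> is abelian, so
  its Sylow \<open>r\<close>-subgroup, for a prime \<open>r\<close> dividing its order, is unique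
  and therefore normal in \<open>G / D\<close>.\<close>

lemma r_section_exists:
  assumes D: "D \<lhd> G" "D \<noteq> carrier G" and n: "(derived G ^^ n) (carrier G) \<subseteq> D"
  obtains r k H where "Factorial_Ring.prime (r::nat)" "H \<lhd> G" "D \<subset> H" "card H = card D * r ^ k"
proof -
  interpret D: normal D G by (rule D(1))
  define j where "j = (LEAST j. (derived G ^^ j) (carrier G) \<subseteq> D)"
  have j: "(derived G ^^ j) (carrier G) \<subseteq> D" unfolding j_def by (rule LeastI[of _ n]) (rule n)
  have "j \<noteq> 0" using j D D.subset by (intro notI) simp
  then obtain i where i: "j = Suc i" by (cases j) auto
  define A where "A = (derived G ^^ i) (carrier G)"
  have AD: "\<not> A \<subseteq> D" unfolding A_def using not_less_Least[of i "\<lambda>j. (derived G ^^ j) (carrier G) \<subseteq> D"] i j_def by simp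
  have A: "A \<lhd> G" unfolding A_def by (rule derived_exp_normal)
  interpret A: normal A G by (rule A)
  let ?E = "A <#> D"
  have E: "?E \<lhd> G" by (rule set_mult_normal[OF A D(1)])
  interpret E: normal ?E G by (rule E)
  have AE: "A \<subseteq> ?E" "D \<subseteq> ?E" using subset_set_mult[OF A.subgroup_axioms D.subgroup_axioms] .
  have "derived G A \<subseteq> D" using j by (simp add: A_def i)
  then have "A \<subseteq> cent A D" using derived_subset_iff_cent[OF D.subgroup_axioms A.subset] by simp
  then have EA: "?E \<subseteq> cent A D"
    by (rule set_mult_subset_sub[OF cent_subgroup[OF D(1) A.subset] _ normal_subset_cent[OF D(1) A.subset]])
  \<comment> \<open>That \<open>?E\<close> centralizes \<open>A\<close> modulo \<open>D\<close> is
    turned around, to conclude that \<open>?E / D\<close> is abelian.\<close>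
  have "A \<subseteq> cent ?E D"
  proof
    fix a assume a: "a \<in> A"
    have "a \<otimes> y \<otimes> inv a \<otimes> inv y \<in> D" if y: "y \<in> ?E" for y
    proof (rule cent_sym[OF D.subgroup_axioms])
      show "y \<otimes> a \<otimes> inv y \<otimes> inv a \<in> D" using subsetD[OF EA y] a by (simp add: cent_def)
    qed (use a y in simp_all)
    then show "a \<in> cent ?E D" using a by (simp add: cent_def)
  qed
  then have EE: "?E \<subseteq> cent ?E D"
    by (rule set_mult_subset_sub[OF cent_subgroup[OF D(1) E.subset] _ normal_subset_cent[OF D(1) E.subset]])
  obtain q where q: "card ?E = card D * q" using card_sub_dvd[OF D.subgroup_axioms E.subgroup_axioms AE(2)] by blast
  have "q \<noteq> 1"
  proof
    assume "q = 1"
    then have "D = ?E" using card_subset_eq[OF finite_sub[OF E.subgroup_axioms] AE(2)] q by simp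
    then show False using AE AD by blast
  qed
  then obtain r where r: "Factorial_Ring.prime r" "r dvd q" using prime_factor_nat by blast
  obtain H where H: "H \<in> syl r D ?E" using syl_exists[OF D(1) E.subgroup_axioms AE(2) r(1)] by blast
  then have H': "subgroup H G" "D \<subseteq> H" "H \<subseteq> ?E" "\<not> r * card H dvd card ?E" by (auto simp: syl_def)
  interpret H: subgroup H G by (rule H'(1))
  obtain k where k: "card H = card D * r ^ k" using H by (auto simp: syl_def)
  have "D \<noteq> H" using H'(4) q r(2) by (auto simp: mult.commute)
  have ee: "cj e H = H" if e: "e \<in> ?E" for e
  proof (rule cj_subset_eq[OF _ H'(1)])
    show ec: "e \<in> carrier G" using e by simp
    show "cj e H \<subseteq> H"
    proof -
      have "e \<otimes> h \<otimes> inv e \<in> H" if h: "h \<in> H" for h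
      proof -
        have "e \<otimes> h \<otimes> inv e \<otimes> inv h \<in> H" using subsetD[OF EE e] h H'(2,3) by (auto simp: cent_def)
        then have "e \<otimes> h \<otimes> inv e \<otimes> inv h \<otimes> h \<in> H" using h by simp
        then show ?thesis using ec h by (simp add: m_assoc)
      qed
      then show ?thesis by (auto simp: cj_def)
    qed
  qed
  \<comment> \<open>The conjugate is again Sylow in \<open>?E\<close>, hence conjugate to
    \<open>H\<close> under \<open>?E\<close>, which normalizes \<open>H\<close>.\<close>
  have "cj x H = H" if x: "x \<in> carrier G" for x
  proof -
    have "cj x H \<subseteq> ?E" using cj_mono[OF H'(3), of x] cj_normal[OF E x] by simp
    then have "cj x H \<in> syl r D ?E" by (rule syl_cj[OF D(1) H x])
    then obtain e where "e \<in> ?E" "cj x H = cj e H" using syl_conjugate[OF D(1) E.subgroup_axioms r(1) H] by blast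
    then show ?thesis using ee by simp
  qed
  then have "nrm H = carrier G" by (auto simp: nrm_def)
  then have "H \<lhd> G" by (rule nrm_carrier_imp_normal[OF H'(1)])
  then show thesis using that[OF r(1)] k H'(2) \<open>D \<noteq> H\<close> by blast
qed

end

text \<open>\<open>L\<close> is the soluble residual, being perfect with soluble quotient, and
  \<open>L / M\<close> is a chief factor of \<open>G\<close>.\<close>

locale perfect_chief = fin_group +
  fixes L M :: "'a set" and n :: nat
  assumes L: "L \<lhd> G" and perf: "derived G L = L" and sol: "(derived G ^^ n) (carrier G) \<subseteq> L"
    and M: "M \<lhd> G" and M_less: "M \<subset> L"
    and chief: "\<And>K. K \<lhd> G \<Longrightarrow> M \<subseteq> K \<Longrightarrow> K \<subseteq> L \<Longrightarrow> K = M \<or> K = L"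
begin

interpretation L: normal L G by (rule L)
interpretation M: normal M G by (rule M)

definition C where "C = cent L M"

lemma C_normal: "C \<lhd> G"
  unfolding C_def by (rule cent_normal[OF M L])

interpretation C: normal C G by (rule C_normal)

lemma CD: "c \<in> C \<Longrightarrow> l \<in> L \<Longrightarrow> c \<otimes> l \<otimes> inv c \<otimes> inv l \<in> M"
  unfolding C_def cent_def by blast

lemma MC: "M \<subseteq> C"
  unfolding C_def by (rule normal_subset_cent[OF M L.subset])

text \<open>\<open>L / M\<close> is perfect and nontrivial, so it is not abelian.\<close>

lemma not_LC: "\<not> L \<subseteq> C"
proof
  assume "L \<subseteq> C"
  then have "derived G L \<subseteq> M"
    unfolding C_def using derived_subset_iff_cent[OF M.subgroup_axioms L.subset] by simp
  then show False using perf M_less by simp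
qed

lemma LC: "L \<inter> C = M"
  using chief[OF normal_subgroup_intersect[OF L C_normal]] MC M_less not_LC by blast

lemma L_subset_derived: "L \<subseteq> (derived G ^^ i) (carrier G)"
  using mono_exp_of_derived[OF L.subset, of i] perfect_derived_exp[OF perf, of i] by simp

text \<open>\<open>U \<inter> L\<close> is normalized by \<open>U\<close> and by \<open>C\<close>,
  so it is normal in \<open>G\<close> and equals \<open>M\<close> or \<open>L\<close>. If it were
  \<open>M\<close>, the \<open>n\<close>-th derived subgroup of \<open>U\<close> would lie in
  \<open>C\<close>; then \<open>G / C\<close> would be soluble, although \<open>L\<close> is perfect
  and not inside \<open>C\<close>.\<close>

lemma supplement_eq_carrier:
  assumes U: "subgroup U G" "M \<subseteq> U" "U <#> L = carrier G" "U <#> C = carrier G"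
  shows "U = carrier G"
proof -
  interpret U: subgroup U G by (rule U(1))
  have "U \<inter> L \<lhd> G"
  proof (rule normal_invI)
    show "subgroup (U \<inter> L) G" by (rule subgroups_Inter_pair[OF U(1) L.subgroup_axioms])
    fix g y assume g: "g \<in> carrier G" and y: "y \<in> U \<inter> L"
    have "g \<in> U <#> C" using g U(4) by simp
    then obtain x c where xc: "x \<in> U" "c \<in> C" "g = x \<otimes> c" by (rule set_multE)
    have xg: "x \<in> carrier G" "c \<in> carrier G" "y \<in> carrier G" using xc y by simp_all
    have "c \<otimes> y \<otimes> inv c \<otimes> inv y \<in> M" using CD[OF xc(2)] y by blast
    then have "c \<otimes> y \<otimes> inv c \<otimes> inv y \<in> U" by (rule subsetD[OF U(2)])
    from U.m_closed[OF this, of y] have "c \<otimes> y \<otimes> inv c \<otimes> inv y \<otimes> y \<in> U" using y by blast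
    then have "c \<otimes> y \<otimes> inv c \<in> U" using xg by (simp add: m_assoc)
    from U.m_closed[OF U.m_closed[OF xc(1) this] U.m_inv_closed[OF xc(1)]]
    have "x \<otimes> (c \<otimes> y \<otimes> inv c) \<otimes> inv x \<in> U" .
    then have "g \<otimes> y \<otimes> inv g \<in> U" unfolding xc(3) using xg by (simp add: m_assoc inv_mult_group)
    moreover have "g \<otimes> y \<otimes> inv g \<in> L" using y by (intro L.inv_op_closed2[OF g]) simp
    ultimately show "g \<otimes> y \<otimes> inv g \<in> U \<inter> L" by blast
  qed
  then consider "U \<inter> L = M" | "U \<inter> L = L" using chief[of "U \<inter> L"] U(2) M_less by blast
  then show ?thesis
  proof cases
    case 1
    have "(derived G ^^ n) U \<subseteq> L" using mono_exp_of_derived[OF U.subset, of n] sol by blast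
    moreover have "(derived G ^^ n) U \<subseteq> U" by (induction n) (simp_all add: derived_incl[OF _ U(1)])
    ultimately have "(derived G ^^ n) U \<subseteq> C" using 1 MC by blast
    then have "(derived G ^^ n) (carrier G) \<subseteq> C" by (rule derived_exp_subset_of_set_mult[OF C_normal U(1,4)])
    then show ?thesis using not_LC L_subset_derived by blast
  next
    case 2
    then show ?thesis using set_mult_absorb(1)[OF U(1) _ L.one_closed] U(3) by blast
  qed
qed

text \<open>Downward induction. The values of \<open>\<mu>\<close> above \<open>Z\<close> and those
  above the proper subgroup \<open>Z <#> C\<close> both sum to zero. In the difference every term
  except \<open>\<mu> Z\<close> vanishes by induction.\<close>

lemma sub_mobius_eq_0:
  assumes "subgroup Z G" "M \<subseteq> Z" "Z <#> L = carrier G" "\<not> C \<subseteq> Z"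
  shows "\<mu> Z = 0"
  using assms
proof (induction "card (carrier G - Z)" arbitrary: Z rule: less_induct)
  case less
  let ?A = "{Y. subgroup Y G \<and> Z \<subseteq> Y}" and ?B = "{Y. subgroup Y G \<and> Z <#> C \<subseteq> Y}"
  have nG: "Z \<noteq> carrier G" using less.prems C.subset by blast
  have ZC: "subgroup (Z <#> C) G" by (rule set_mult_normal_subgroup[OF less.prems(1) C_normal])
  have sub: "Z \<subseteq> Z <#> C" "C \<subseteq> Z <#> C" using subset_set_mult[OF less.prems(1) C.subgroup_axioms] .
  have "Z <#> C \<noteq> carrier G" using supplement_eq_carrier[OF less.prems(1-3)] nG by blast
  then have "sum \<mu> ?B = 0" by (rule sum_mobius_above[OF ZC])
  moreover have "sum \<mu> ?A = 0" by (rule sum_mobius_above[OF less.prems(1) nG])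
  moreover have "sum \<mu> ?A = sum \<mu> (?A - ?B) + sum \<mu> ?B"
    by (rule sum.subset_diff) (use sub in \<open>auto simp: finite_subgroups\<close>)
  moreover have "sum \<mu> (?A - ?B) = \<mu> Z + sum \<mu> (?A - ?B - {Z})"
    by (rule sum.remove) (use sub less.prems in \<open>auto simp: finite_subgroups\<close>)
  moreover have "sum \<mu> (?A - ?B - {Z}) = 0"
  proof (rule sum.neutral, rule)
    fix Y assume Y: "Y \<in> ?A - ?B - {Z}"
    then have Y': "subgroup Y G" "Z \<subset> Y" "\<not> Z <#> C \<subseteq> Y" by auto
    have "carrier G - Y \<subset> carrier G - Z" using Y' subgroup.subset[OF Y'(1)] by blast
    then have "card (carrier G - Y) < card (carrier G - Z)" using fin by (simp add: psubset_card_mono)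
    moreover have "\<not> C \<subseteq> Y" using set_mult_subset_sub[OF Y'(1), of Z C] Y'(2,3) by blast
    moreover have "Z <#> L \<subseteq> Y <#> L" using Y' by (intro mono_set_mult) auto
    then have "Y <#> L = carrier G"
      using less.prems(3) set_mult_closed[OF subgroup.subset[OF Y'(1)] L.subset] by simp
    ultimately show "\<mu> Y = 0" using less.hyps[of Y] Y' less.prems(2) by blast
  qed
  ultimately show ?case by linarith
qed

lemma m_sum_M_eq_C: "m_sum M L = m_sum C L"
  unfolding m_sum_def
proof (rule sum.mono_neutral_right)
  show "\<forall>Z\<in>{Z. subgroup Z G \<and> M \<subseteq> Z \<and> Z <#> L = carrier G} -
         {Z. subgroup Z G \<and> C \<subseteq> Z \<and> Z <#> L = carrier G}. int (card Z) * \<mu> Z = 0"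
    using sub_mobius_eq_0 by auto
qed (use MC in \<open>auto simp: finite_subgroups\<close>)

text \<open>\<open>G / C\<close> is not cyclic, since otherwise it would be abelian and
  \<open>C\<close> would contain the derived subgroup, hence \<open>L\<close>.\<close>

lemma generate_insert_neq:
  assumes x: "x \<in> carrier G"
  shows "generate G (insert x C) \<noteq> carrier G"
proof
  assume gen: "generate G (insert x C) = carrier G"
  have all: "carrier G \<subseteq> K" if "subgroup K G" "x \<in> K" "C \<subseteq> K" for K
    using generate_subgroup_incl[of "insert x C" K] that gen by simp
  have "carrier G \<subseteq> cent {x} C"
  proof (rule all)
    show "subgroup (cent {x} C) G" using x by (intro cent_subgroup[OF C_normal]) simp
    show "x \<in> cent {x} C" using x by (simp add: cent_def m_assoc)
    show "C \<subseteq> cent {x} C" using x by (intro normal_subset_cent[OF C_normal]) simp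
  qed
  then have "g \<otimes> x \<otimes> inv g \<otimes> inv x \<in> C" if "g \<in> carrier G" for g using that by (auto simp: cent_def)
  then have "x \<otimes> g \<otimes> inv x \<otimes> inv g \<in> C" if "g \<in> carrier G" for g
    using that x cent_sym[OF C.subgroup_axioms] by blast
  then have "x \<in> cent (carrier G) C" using x by (simp add: cent_def)
  then have "carrier G \<subseteq> cent (carrier G) C"
    by (intro all[OF cent_subgroup[OF C_normal subset_refl] _ normal_subset_cent[OF C_normal subset_refl]])
  then have "derived G (carrier G) \<subseteq> C" using derived_subset_iff_cent[OF C.subgroup_axioms subset_refl] by simp
  then show False using not_LC L_subset_derived[of 1] by simp
qed

text \<open>Here every \<open>Z\<close> above \<open>C\<close> is a supplement of \<open>L\<close>.
  Writing \<open>card Z\<close> as a count of elements and exchanging sums leaves, for each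
  \<open>x\<close>, the sum of \<open>\<mu>\<close> over the subgroups above the proper subgroup
  generated by \<open>x\<close> and \<open>C\<close>.\<close>

lemma m_sum_eq_0_of_product:
  assumes CL: "C <#> L = carrier G"
  shows "m_sum C L = 0"
proof -
  let ?S = "{Z. subgroup Z G \<and> C \<subseteq> Z}"
  have "Z <#> L = carrier G" if "Z \<in> ?S" for Z
  proof -
    have "C <#> L \<subseteq> Z <#> L" using that by (intro mono_set_mult) auto
    then show ?thesis using CL that set_mult_closed[OF _ L.subset, of Z] subgroup.subset[of Z G] by auto
  qed
  then have S: "{Z. subgroup Z G \<and> C \<subseteq> Z \<and> Z <#> L = carrier G} = ?S" by blast
  have c: "int (card Z) = (\<Sum>x\<in>carrier G. if x \<in> Z then 1 else 0)" if "Z \<in> ?S" for Z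
  proof -
    have "carrier G \<inter> Z = Z" using that subgroup.subset by blast
    then show ?thesis using sum.inter_restrict[OF fin, of "\<lambda>_. 1::int" Z] by simp
  qed
  have "m_sum C L = (\<Sum>Z\<in>?S. \<Sum>x\<in>carrier G. (if x \<in> Z then 1 else 0) * \<mu> Z)"
    unfolding m_sum_def S by (rule sum.cong[OF refl]) (simp only: c sum_distrib_right)
  also have "\<dots> = (\<Sum>x\<in>carrier G. \<Sum>Z\<in>?S. (if x \<in> Z then 1 else 0) * \<mu> Z)" by (rule sum.swap)
  also have "\<dots> = 0"
  proof (rule sum.neutral, rule)
    fix x assume x: "x \<in> carrier G"
    let ?H = "generate G (insert x C)"
    have sub: "insert x C \<subseteq> carrier G" using x C.subset by simp
    have "(\<Sum>Z\<in>?S. (if x \<in> Z then 1 else 0) * \<mu> Z) = (\<Sum>Z\<in>{Z. subgroup Z G \<and> ?H \<subseteq> Z}. \<mu> Z)"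
    proof (rule sum.mono_neutral_cong_right)
      have iff: "?H \<subseteq> Z \<longleftrightarrow> C \<subseteq> Z \<and> x \<in> Z" if "subgroup Z G" for Z
        using generate_subgroup_incl[of "insert x C" Z] that generate.incl[of _ "insert x C" G] by blast
      show "{Z. subgroup Z G \<and> ?H \<subseteq> Z} \<subseteq> ?S" using iff by blast
      show "\<forall>Z\<in>?S - {Z. subgroup Z G \<and> ?H \<subseteq> Z}. (if x \<in> Z then 1 else 0) * \<mu> Z = 0" using iff by auto
      show "(if x \<in> Z then 1 else 0) * \<mu> Z = \<mu> Z" if "Z \<in> {Z. subgroup Z G \<and> ?H \<subseteq> Z}" for Z
        using iff that by auto
    qed (rule finite_subgroups)
    also have "\<dots> = 0"
      by (rule sum_mobius_above[OF generate_is_subgroup[OF sub] generate_insert_neq[OF x]])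
    finally show "(\<Sum>Z\<in>?S. (if x \<in> Z then 1 else 0) * \<mu> Z) = 0" .
  qed
  finally show ?thesis .
qed

text \<open>A nontrivial \<open>r\<close>-group has a nontrivial centre, but the centre of
  \<open>L / M\<close> is \<open>(L \<inter> C) / M\<close>, which is trivial. The count uses
  conjugation by \<open>L\<close> on the cosets of \<open>M\<close>, where only \<open>M\<close> is
  fixed.\<close>

lemma index_not_prime_power:
  assumes r: "Factorial_Ring.prime (r::nat)"
  shows "card L \<noteq> card M * r ^ i"
proof
  assume i: "card L = card M * r ^ i"
  let ?E = "(\<lambda>x. M #> x) ` L"
  have cjM: "cj l (M #> x) = M #> (l \<otimes> x \<otimes> inv l)" if l: "l \<in> carrier G" and x: "x \<in> carrier G" for l x
  proof -
    have "cj l (M #> x) = (\<lambda>m. m \<otimes> (l \<otimes> x \<otimes> inv l)) ` cj l M"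
    proof -
      have "l \<otimes> (m \<otimes> x) \<otimes> inv l = (l \<otimes> m \<otimes> inv l) \<otimes> (l \<otimes> x \<otimes> inv l)" if "m \<in> M" for m
        using that l x by (simp add: m_assoc inv_cancel)
      then have "(\<lambda>y. l \<otimes> y \<otimes> inv l) ` (\<lambda>m. m \<otimes> x) ` M = (\<lambda>m. m \<otimes> (l \<otimes> x \<otimes> inv l)) ` (\<lambda>y. l \<otimes> y \<otimes> inv l) ` M"
        unfolding image_image by (rule image_cong[OF refl])
      moreover have "M #> x = (\<lambda>m. m \<otimes> x) ` M" by (auto simp: r_coset_def)
      ultimately show ?thesis by (simp only: cj_def)
    qed
    also have "\<dots> = M #> (l \<otimes> x \<otimes> inv l)" unfolding cj_normal[OF M l] by (auto simp: r_coset_def)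
    finally show ?thesis .
  qed
  have fix_iff: "cj l (M #> x) = M #> x \<longleftrightarrow> l \<otimes> x \<otimes> inv l \<otimes> inv x \<in> M"
    if "l \<in> carrier G" "x \<in> carrier G" for l x
    unfolding cjM[OF that] using that by (intro rcos_eq_iff[OF M.subgroup_axioms]) simp_all
  have "r dvd card ?E \<longleftrightarrow> r dvd card {V \<in> ?E. \<forall>l\<in>L. cj l V = V}"
  proof (rule fixed_points_cong[of L M r i ?E cj])
    show "subgroup L G" "subgroup M G" "M \<subseteq> L" "Factorial_Ring.prime r" "card L = card M * r ^ i"
      using L.subgroup_axioms M.subgroup_axioms M_less r i by blast+
    show "finite ?E" using finite_sub[OF L.subgroup_axioms] by (rule finite_imageI)
    show "cj l V \<in> ?E" if h: "l \<in> L" "V \<in> ?E" for l V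
    proof -
      obtain x where x: "x \<in> L" "V = M #> x" using h by blast
      then show ?thesis using h cjM[of l x] by auto
    qed
    show "cj (g \<otimes> l) V = cj g (cj l V)" if h: "g \<in> L" "l \<in> L" "V \<in> ?E" for g l V
    proof (rule cj_mult)
      obtain x where x: "x \<in> L" "V = M #> x" using h by blast
      show "V \<subseteq> carrier G" unfolding x(2) by (rule r_coset_subset_G[OF M.subset L.mem_carrier[OF x(1)]])
    qed (use h in simp_all)
    show "cj m V = V" if h: "m \<in> M" "V \<in> ?E" for m V
    proof -
      obtain x where x: "x \<in> L" "V = M #> x" using h by blast
      have "m \<in> cent L M" using normal_subset_cent[OF M L.subset] h by blast
      then show ?thesis using x fix_iff[of m x] h by (auto simp: cent_def)
    qed
  qed
  moreover have "{V \<in> ?E. \<forall>l\<in>L. cj l V = V} = {M}"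
  proof (intro equalityI subsetI)
    fix V assume "V \<in> {V \<in> ?E. \<forall>l\<in>L. cj l V = V}"
    then obtain x where x: "x \<in> L" "V = M #> x" "\<forall>l\<in>L. cj l (M #> x) = M #> x" by blast
    have "x \<otimes> l \<otimes> inv x \<otimes> inv l \<in> M" if l: "l \<in> L" for l
    proof -
      have c: "l \<in> carrier G" "x \<in> carrier G" using l x(1) by simp_all
      have "l \<otimes> x \<otimes> inv l \<otimes> inv x \<in> M" using x(3) l fix_iff[OF c] by blast
      then show ?thesis by (rule cent_sym[OF M.subgroup_axioms c])
    qed
    then have "x \<in> C" using L.mem_carrier[OF x(1)] unfolding C_def cent_def by blast
    then have "x \<in> M" using x LC by blast
    then show "V \<in> {M}" using x(2) M.rcos_const[OF is_group] by simp
  next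
    fix V assume V: "V \<in> {M}"
    have "M = M #> \<one>" using M.subset by simp
    then have "M \<in> ?E" using L.one_closed by (rule image_eqI)
    moreover have "\<forall>l\<in>L. cj l M = M" using cj_normal[OF M L.mem_carrier] by blast
    ultimately show "V \<in> {V \<in> ?E. \<forall>l\<in>L. cj l V = V}" using V by simp
  qed
  ultimately have "\<not> r dvd card ?E" using r by (simp add: prime_nat_iff)
  moreover have "card ?E = r ^ i"
    using card_rcosets_sub[OF M.subgroup_axioms L.subgroup_axioms] M_less i card_sub_pos[OF M.subgroup_axioms]
    by (auto simp: mult.commute)
  ultimately have "i = 0" by (cases i) simp_all
  then show False
    using i M_less card_subset_eq[OF finite_sub[OF L.subgroup_axioms], of M] by auto
qed

text \<open>When \<open>C <#> L\<close> is proper, a normal \<open>R\<close> with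
  \<open>R / C\<close> an \<open>r\<close>-group must be shown to lie in \<open>C <#> L\<close>. If
  \<open>R \<inter> L = M\<close>, commutators of \<open>R\<close> and \<open>L\<close> lie in
  \<open>M\<close>, so \<open>R \<subseteq> C\<close>. If \<open>R \<inter> L = L\<close>, then
  \<open>L / M\<close>, having the order of \<open>C L / C\<close>, would be an
  \<open>r\<close>-group.\<close>

theorem m_sum_M_eq_0: "m_sum M L = 0"
proof (cases "C <#> L = carrier G")
  case True
  then show ?thesis using m_sum_M_eq_C m_sum_eq_0_of_product by simp
next
  case False
  have CL: "C <#> L \<lhd> G" by (rule set_mult_normal[OF C_normal L])
  have sub: "C \<subseteq> C <#> L" "L \<subseteq> C <#> L" using subset_set_mult[OF C.subgroup_axioms L.subgroup_axioms] .
  have "(derived G ^^ n) (carrier G) \<subseteq> C <#> L" by (rule subset_trans[OF sol sub(2)])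
  then obtain r k H where H: "Factorial_Ring.prime r" "H \<lhd> G" "C <#> L \<subset> H" "card H = card (C <#> L) * r ^ k"
    by (rule r_section_exists[OF CL False])
  interpret r_section G C L H r k
    by (intro r_section.intro r_section_axioms.intro fin_group_axioms C_normal L H)
  have "m_sum C L = 0"
  proof (rule m_sum_eq_0)
    fix R j assume R: "R \<lhd> G" "C \<subseteq> R" "card R = card C * r ^ j"
    interpret R: normal R G by (rule R(1))
    have "R \<inter> L \<lhd> G" by (rule normal_subgroup_intersect[OF R(1) L])
    then consider "R \<inter> L = M" | "R \<inter> L = L" using chief[of "R \<inter> L"] R(2) MC M_less by blast
    then show "R \<subseteq> C <#> L"
    proof cases
      case 1
      have "x \<in> C" if x: "x \<in> R" for x
      proof -
        have "x \<otimes> l \<otimes> inv x \<otimes> inv l \<in> M" if l: "l \<in> L" for l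
        proof -
          have "x \<otimes> l \<otimes> inv x \<in> L" using x l by (intro L.inv_op_closed2) simp_all
          then have "x \<otimes> l \<otimes> inv x \<otimes> inv l \<in> L" using l by simp
          moreover have "l \<otimes> inv x \<otimes> inv l \<in> R" using x l by (intro R.inv_op_closed2) simp_all
          then have "x \<otimes> (l \<otimes> inv x \<otimes> inv l) \<in> R" using x by simp
          then have "x \<otimes> l \<otimes> inv x \<otimes> inv l \<in> R" using x l by (simp add: m_assoc)
          ultimately show ?thesis using 1 by blast
        qed
        then show ?thesis using R.mem_carrier[OF x] unfolding C_def cent_def by blast
      qed
      then show ?thesis using sub by blast
    next
      case 2
      have CLs: "subgroup (C <#> L) G" by (rule normal_imp_subgroup[OF CL])
      have "C <#> L \<subseteq> R" using R(2) 2 by (intro set_mult_subset_sub[OF R.subgroup_axioms]) auto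
      then have "card (C <#> L) dvd card C * r ^ j" using card_sub_dvd[OF CLs R.subgroup_axioms] R(3) by simp
      moreover obtain u where u: "card (C <#> L) = card C * u"
        using card_sub_dvd[OF C.subgroup_axioms CLs sub(1)] by blast
      ultimately have "u dvd r ^ j" using card_sub_pos[OF C.subgroup_axioms] by simp
      then obtain i where "u = r ^ i" using divides_primepow_nat[OF r] by blast
      moreover have "C \<inter> L = M" using LC by blast
      then have "card L = card M * u"
        using card_set_mult[OF C.subgroup_axioms L.subgroup_axioms] card_sub_pos[OF C.subgroup_axioms] u
        by (simp add: mult.commute mult.left_commute)
      ultimately show ?thesis using index_not_prime_power[OF r] by blast
    qed
  qed
  then show ?thesis using m_sum_M_eq_C by simp
qed

end

subsection \<open>Soluble quotients\<close>

lemma (in group) solvable_subgroup_structure: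
  assumes H: "subgroup H G" and "solvable G"
  shows "solvable (G\<lparr>carrier := H\<rparr>)"
proof -
  have "(\<lambda>x. x) \<in> hom (G\<lparr>carrier := H\<rparr>) G" using subgroup.subset[OF H] by (auto simp: hom_def)
  then interpret h: group_hom "G\<lparr>carrier := H\<rparr>" G "\<lambda>x. x"
    unfolding group_hom_def group_hom_axioms_def using subgroup_imp_group[OF H] is_group by blast
  show ?thesis by (rule h.inj_hom_imp_solvable) (use assms in auto)
qed

text \<open>The derived subgroup is normal, hence trivial or everything; in the second case the
  derived series never descends.\<close>

lemma (in simple_group) solvable_imp_comm_group:
  assumes "solvable G"
  shows "comm_group G"
proof -
  consider "derived G (carrier G) = carrier G" | "derived G (carrier G) = {\<one>}"
    using no_real_normal_subgroup[OF derived_self_is_normal] by blast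
  then show ?thesis
  proof cases
    case 1
    have "(derived G ^^ n) (carrier G) = carrier G" for n by (induction n) (simp_all add: 1)
    then show ?thesis using assms simple_not_triv unfolding solvable_iff_trivial_derived_seq by simp
  next
    case 2
    show ?thesis
    proof (rule group_comm_groupI)
      fix x y assume xy: "x \<in> carrier G" "y \<in> carrier G"
      have "x \<otimes> y \<otimes> inv x \<otimes> inv y \<in> derived_set G (carrier G)" using xy by auto
      then have "x \<otimes> y \<otimes> inv x \<otimes> inv y \<in> derived G (carrier G)" unfolding derived_def by (rule generate.incl)
      then have "x \<otimes> y \<otimes> inv x \<otimes> inv y = \<one>" using 2 by simp
      then have "x \<otimes> y \<otimes> inv (y \<otimes> x) = \<one>" using xy by (simp add: m_assoc inv_mult_group)
      then have "inv (inv (y \<otimes> x)) = x \<otimes> y" using xy by (intro inv_equality) simp_all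
      then show "x \<otimes> y = y \<otimes> x" using xy by simp
    qed
  qed
qed

text \<open>Solubility passes to subgroups, quotients and isomorphic copies.\<close>

lemma solvable_imp_comm_factor:
  assumes "group G" "solvable G" "subgroup H G" "K \<lhd> G\<lparr>carrier := H\<rparr>"
    and "simple_group S" "G\<lparr>carrier := H\<rparr> Mod K \<cong> S"
  shows "comm_group S"
proof -
  let ?H = "G\<lparr>carrier := H\<rparr>"
  interpret G: group G by fact
  interpret S: simple_group S by fact
  interpret K: normal K ?H by fact
  interpret h: group_hom ?H "?H Mod K" "\<lambda>x. K #>\<^bsub>?H\<^esub> x"
    unfolding group_hom_def group_hom_axioms_def
    using K.factorgroup_is_group K.r_coset_hom_Mod K.is_group by blast
  have "solvable ?H" by (rule G.solvable_subgroup_structure[OF assms(3,2)])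
  then have Q: "solvable (?H Mod K)" by (rule h.surj_hom_imp_solvable[rotated]) (simp add: carrier_FactGroup)
  obtain f where f: "f \<in> iso (?H Mod K) S" using assms(6) by (auto simp: is_iso_def)
  interpret f: group_hom "?H Mod K" S f
    unfolding group_hom_def group_hom_axioms_def
    using K.factorgroup_is_group S.is_group f by (auto simp: iso_def)
  have "solvable S" by (rule f.surj_hom_imp_solvable[OF _ Q]) (use f in \<open>auto simp: iso_def bij_betw_def\<close>)
  then show ?thesis by (rule S.solvable_imp_comm_group)
qed

context fin_group
begin

text \<open>A term of least order in the derived series cannot shrink further.\<close>

lemma solvable_residual_exists:
  obtains n where "derived G ((derived G ^^ n) (carrier G)) = (derived G ^^ n) (carrier G)"
proof -
  let ?d = "\<lambda>n. (derived G ^^ n) (carrier G)"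
  obtain n where n: "\<And>m. card (?d n) \<le> card (?d m)"
    using ex_has_least_nat[of "\<lambda>_. True" 0 "\<lambda>n. card (?d n)"] by auto
  have "derived G (?d n) \<subseteq> ?d n"
    by (rule derived_incl[OF subset_refl normal_imp_subgroup[OF derived_exp_normal]])
  moreover have "card (?d n) \<le> card (derived G (?d n))" using n[of "Suc n"] by simp
  ultimately have "derived G (?d n) = ?d n"
    using card_seteq[OF finite_sub[OF normal_imp_subgroup[OF derived_exp_normal]]] by blast
  then show thesis by (rule that)
qed

lemma derived_exp_subset_of_solvable_Mod:
  assumes N: "N \<lhd> G" and "solvable (G Mod N)"
  obtains m where "(derived G ^^ m) (carrier G) \<subseteq> N"
proof -
  interpret N: normal N G by fact
  interpret h: group_hom G "G Mod N" "\<lambda>x. N #> x" by (rule hom_Mod[OF N])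
  obtain m where m: "(derived (G Mod N) ^^ m) (carrier (G Mod N)) = {N}"
    using assms(2) h.H.solvable_iff_trivial_derived_seq by auto
  have "(derived G ^^ m) (carrier G) \<subseteq> N"
  proof
    fix g assume g: "g \<in> (derived G ^^ m) (carrier G)"
    have gc: "g \<in> carrier G" using g exp_of_derived_in_carrier[OF subset_refl] by blast
    have "N #> g \<in> (\<lambda>x. N #> x) ` (derived G ^^ m) (carrier G)" using g by (rule imageI)
    then have "N #> g = N"
      using m unfolding h.exp_of_derived_img[OF subset_refl, symmetric] by (simp add: carrier_FactGroup)
    then show "g \<in> N" by (rule coset_join1[OF _ gc N.subgroup_axioms])
  qed
  then show thesis by (rule that)
qed

lemma maximal_normal_below:
  assumes L: "L \<lhd> G" "L \<noteq> {\<one>}"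
  obtains M where "M \<lhd> G" "M \<subset> L" "\<forall>K. K \<lhd> G \<longrightarrow> M \<subseteq> K \<longrightarrow> K \<subseteq> L \<longrightarrow> K = M \<or> K = L"
proof -
  let ?F = "{M. M \<lhd> G \<and> M \<subset> L}"
  have "finite ?F"
    by (rule finite_subset[of _ "Pow (carrier G)"]) (auto simp: fin dest: normal_imp_subgroup subgroup.subset)
  moreover have "\<one> \<in> L" by (rule subgroup.one_closed[OF normal_imp_subgroup[OF L(1)]])
  then have "{\<one>} \<subset> L" using L(2) by blast
  then have "?F \<noteq> {}" using one_is_normal by blast
  ultimately have "\<exists>M\<in>?F. \<forall>K\<in>?F. M \<subseteq> K \<longrightarrow> M = K" by (rule finite_has_maximal)
  then obtain M where M: "M \<lhd> G" "M \<subset> L" "\<forall>K\<in>?F. M \<subseteq> K \<longrightarrow> M = K" by blast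
  show thesis by (rule that[of M]) (use M in blast)+
qed

text \<open>\<open>L\<close> is perfect, so it lies in every derived subgroup and thus in
  \<open>N\<close>. Transitivity along \<open>M\<close>, \<open>L\<close>, \<open>N\<close> gives
  \<open>m_sum M N = 0\<close>, and along \<open>{\<one>}\<close>, \<open>M\<close>,
  \<open>N\<close> it carries this down to \<open>m_sum {\<one>} N\<close>.\<close>

theorem m_GN_eq_0:
  assumes N: "N \<lhd> G" and solv: "solvable (G Mod N)" and nonsolv: "\<not> solvable G"
  shows "m_GN G N = 0"
proof -
  obtain n where n: "derived G ((derived G ^^ n) (carrier G)) = (derived G ^^ n) (carrier G)"
    by (rule solvable_residual_exists)
  define L where "L = (derived G ^^ n) (carrier G)"
  have L: "L \<lhd> G" unfolding L_def by (rule derived_exp_normal)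
  have perf: "derived G L = L" using n by (simp add: L_def)
  have "L \<noteq> {\<one>}" using nonsolv by (auto simp: solvable_iff_trivial_derived_seq L_def)
  then obtain M where M: "M \<lhd> G" "M \<subset> L" "\<forall>K. K \<lhd> G \<longrightarrow> M \<subseteq> K \<longrightarrow> K \<subseteq> L \<longrightarrow> K = M \<or> K = L"
    by (rule maximal_normal_below[OF L])
  interpret P: perfect_chief G L M n
    by (intro perfect_chief.intro perfect_chief_axioms.intro fin_group_axioms L perf M(1,2) M(3)[rule_format])
      (simp_all add: L_def)
  obtain m where "(derived G ^^ m) (carrier G) \<subseteq> N"
    by (rule derived_exp_subset_of_solvable_Mod[OF N solv])
  then have LN: "L \<subseteq> N" using P.L_subset_derived[of m] by simp
  have pos: "int (card (carrier G)) \<noteq> 0" using card_sub_pos[OF subgroup_self] by simp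
  have "int (card (carrier G)) * m_sum M N = 0"
    unfolding m_sum_mult[OF L N psubset_imp_subset[OF M(2)] LN] P.m_sum_M_eq_0 by simp
  then have "m_sum M N = 0" using pos by simp
  moreover have "{\<one>} \<subseteq> M" using subgroup.one_closed[OF normal_imp_subgroup[OF M(1)]] by simp
  moreover have "M \<subseteq> N" using M(2) LN by blast
  ultimately have "int (card (carrier G)) * m_sum {\<one>} N = 0" using m_sum_mult[OF M(1) N] by simp
  then show ?thesis using pos m_GN_eq_0_iff by simp
qed

end

theorem mainTheorem1:
  fixes G :: "('a, 'b) monoid_scheme" and S :: "('c, 'd) monoid_scheme"
  assumes "group G" and "finite (carrier G)"
    and "simple_group S" and "\<not> comm_group S" and "finite (carrier S)"
    and "\<not> excluded_simple S"
    and "\<exists>Hs. comp_series G Hs \<and> comp_mult G Hs S = 1"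
    and "beta_kernel G N"
  shows "\<not> solvable (G Mod N)"
proof
  assume solv: "solvable (G Mod N)"
  interpret fin_group G by (intro fin_group.intro fin_group_axioms.intro assms)
  obtain Hs where Hs: "comp_series G Hs" "comp_mult G Hs S = 1" using assms(7) by blast
  then obtain i where i: "Suc i < length Hs" "G\<lparr>carrier := Hs ! i\<rparr> Mod (Hs ! Suc i) \<cong> S"
    unfolding comp_mult_def by (auto simp: card_Suc_eq)
  have "subgroup (Hs ! i) G" "Hs ! Suc i \<lhd> G\<lparr>carrier := Hs ! i\<rparr>"
    using Hs(1) i(1) by (auto simp: comp_series_def)
  \<comment> \<open>The nonabelian factor \<open>S\<close> makes \<open>G\<close> insoluble, so a
    soluble \<open>G Mod N\<close> would force \<open>m_GN G N = 0\<close>.\<close>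
  then have "\<not> solvable G" using solvable_imp_comm_factor[OF is_group _ _ _ assms(3) i(2)] assms(4) by blast
  then show False using m_GN_eq_0[OF _ solv] assms(8) by (auto simp: beta_kernel_def)
qed

end
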